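(* Let $T:\mathcal{X}\to\mathcal{X}$, data points $x_1,\dots,x_N$ with $x_i^+=T(x_i)$, and observables be equipped with the empirical inner product $\langle f,g\rangle=\frac1N\sum_{i=1}^N f(x_i)g(x_i)$, with Koopman operator $(\mathcal{K}f)(x)=f(T(x))$. Consider a current search space $\mathcal{S}_k$ spanned by a dictionary $\Psi_k=[\psi_1,\dots,\psi_m]$ such that $A_k=\Psi_k(X)$ and $B_k=\Psi_k(X^+)$ have full column rank. One iteration of the Single-Principal-Vector (SPV) pruning algorithm replaces $\mathcal{S}_k$ by $\mathcal{S}_k\setminus\mathrm{span}(u^{\mathcal{S}}_{\max})$, the orthogonal complement of $u^{\mathcal{S}}_{\max}$ within $\mathcal{S}_k$, where $u^{\mathcal{S}}_{\max}\in\mathcal{S}_k$ is a principal vector of $\mathcal{S}_k$ with respect to $\mathcal{K}\mathcal{S}_k$ associated with the largest principal angle $\theta_{\max}$. One iteration of the Recursive Forward-Backward EDMD (RFB-EDMD) algorithm replaces $\mathcal{S}_k$ by $\mathcal{S}_k\setminus\mathrm{span}\{\Psi_k(\cdot)v_{\max}\}$, where $v_{\max}$ is an eigenvector of the consistency matrix $M_c=I-(A_k^\dagger B_k)(B_k^\dagger A_k)$ associated with its largest eigenvalue $\lambda_{\max}$. Then $\lambda_{\max}=\sin^2\theta_{\max}$ and $\Psi_k(\cdot)v_{\max}$ is a principal vector of $\mathcal{S}_k$ associated with $\theta_{\max}$; consequently the SPV and RFB-EDMD algorithms are algebraically equivalent, removing the identical one-dimensional subspace from the search space at every iteration, and hence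 produce identical sequences of nested subspaces $\mathcal{S}_0\supset\mathcal{S}_1\supset\cdots$ and the same final output.
   Context: $M^\dagger$ is the Moore–Penrose pseudoinverse; $\Psi_k(X)$ and $\Psi_k(X^+)$ are the $N\times m$ matrices with $i$-th rows $\Psi_k(x_i)$ and $\Psi_k(x_i^+)$. Principal angles and vectors between subspaces $\mathcal{U},\mathcal{V}$: angles $0\le\theta_1\le\dots\le\theta_k\le\pi/2$ defined recursively by $\cos\theta_j=\max|\langle u,v\rangle|$ over unit $u\in\mathcal{U}$, $v\in\mathcal{V}$ orthogonal to previously selected principal vectors; maximizers are the $j$-th pair of principal vectors; $\theta_{\max}$ is the largest angle. The SPV algorithm iterates the stated removal until $\sin\theta_{\max}\le\epsilon$ for a tolerance $\epsilon$ (or the subspace becomes empty). *)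

theory Defs
  imports "HOL-Analysis.Analysis"
begin

text \<open>Observables are real-valued functions on the state space 'x.  The data points
  are x i, i ranging over the finite index type 'n (so N = CARD('n)).
  Empirical inner product on observables.\<close>
definition emp_ip :: "('n::finite \<Rightarrow> 'x) \<Rightarrow> ('x \<Rightarrow> real) \<Rightarrow> ('x \<Rightarrow> real) \<Rightarrow> real" where
  "emp_ip xs f g = (\<Sum>i\<in>UNIV. f (xs i) * g (xs i)) / real CARD('n)"

text \<open>Koopman operator.\<close>
definition koopman :: "('x \<Rightarrow> 'x) \<Rightarrow> ('x \<Rightarrow> real) \<Rightarrow> ('x \<Rightarrow> real)" where
  "koopman T f = (\<lambda>y. f (T y))"

text \<open>Dictionary Psi = [psi_1..psi_m] indexed by the finite type 'm; Psi(.) c.\<close>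
definition dict_comb :: "('m::finite \<Rightarrow> 'x \<Rightarrow> real) \<Rightarrow> real^'m \<Rightarrow> ('x \<Rightarrow> real)" where
  "dict_comb \<psi> c = (\<lambda>y. \<Sum>j\<in>UNIV. c $ j * \<psi> j y)"

text \<open>Search space spanned by the dictionary.\<close>
definition dict_span :: "('m::finite \<Rightarrow> 'x \<Rightarrow> real) \<Rightarrow> ('x \<Rightarrow> real) set" where
  "dict_span \<psi> = range (dict_comb \<psi>)"

text \<open>Data matrix Psi(Y): N x m matrix with i-th row Psi(y_i).\<close>
definition data_matrix :: "('m::finite \<Rightarrow> 'x \<Rightarrow> real) \<Rightarrow> ('n::finite \<Rightarrow> 'x) \<Rightarrow> real^'m^'n" where
  "data_matrix \<psi> ys = (\<chi> i j. \<psi> j (ys i))"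

definition full_column_rank :: "real^'m^'n \<Rightarrow> bool" where
  "full_column_rank M \<longleftrightarrow> (\<forall>v. M *v v = 0 \<longrightarrow> v = 0)"

text \<open>Moore--Penrose pseudoinverse (unique matrix satisfying the Penrose equations).\<close>
definition pinv :: "real^'m^'n \<Rightarrow> real^'n^'m" where
  "pinv M = (THE X. M ** X ** M = M \<and> X ** M ** X = X \<and>
                    transpose (M ** X) = M ** X \<and> transpose (X ** M) = X ** M)"

definition real_eigenvector :: "real^'m^'m \<Rightarrow> real \<Rightarrow> real^'m \<Rightarrow> bool" where
  "real_eigenvector M \<mu> v \<longleftrightarrow> v \<noteq> 0 \<and> M *v v = \<mu> *\<^sub>R v"

definition real_eigenvalue :: "real^'m^'m \<Rightarrow> real \<Rightarrow> bool" where
  "real_eigenvalue M \<mu> \<longleftrightarrow> (\<exists>v. real_eigenvector M \<mu> v)"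

text \<open>Principal vectors (recursive definition) w.r.t. the inner product ip:
  a list of pairs (u_j, v_j); the j-th pair consists of unit vectors u_j in U, v_j in V,
  orthogonal to the previously selected u_i resp. v_i, maximizing |<u,v>| among all such.\<close>
definition admissible_pair ::
  "(('x \<Rightarrow> real) \<Rightarrow> ('x \<Rightarrow> real) \<Rightarrow> real) \<Rightarrow> ('x \<Rightarrow> real) set \<Rightarrow> ('x \<Rightarrow> real) set
    \<Rightarrow> (('x \<Rightarrow> real) \<times> ('x \<Rightarrow> real)) list \<Rightarrow> ('x \<Rightarrow> real) \<Rightarrow> ('x \<Rightarrow> real) \<Rightarrow> bool" where
  "admissible_pair ip U V prev u v \<longleftrightarrow>
     u \<in> U \<and> v \<in> V \<and> ip u u = 1 \<and> ip v v = 1 \<and>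
     (\<forall>p\<in>set prev. ip u (fst p) = 0 \<and> ip v (snd p) = 0)"

definition principal_seq ::
  "(('x \<Rightarrow> real) \<Rightarrow> ('x \<Rightarrow> real) \<Rightarrow> real) \<Rightarrow> ('x \<Rightarrow> real) set \<Rightarrow> ('x \<Rightarrow> real) set
    \<Rightarrow> (('x \<Rightarrow> real) \<times> ('x \<Rightarrow> real)) list \<Rightarrow> bool" where
  "principal_seq ip U V ps \<longleftrightarrow>
     (\<forall>j<length ps.
        admissible_pair ip U V (take j ps) (fst (ps ! j)) (snd (ps ! j)) \<and>
        (\<forall>u' v'. admissible_pair ip U V (take j ps) u' v' \<longrightarrow>
                 \<bar>ip u' v'\<bar> \<le> \<bar>ip (fst (ps ! j)) (snd (ps ! j))\<bar>))"

text \<open>A complete sequence: no further unit vector of U (or of V) orthogonal to the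
  already selected ones exists, i.e. its length is min(dim U, dim V).\<close>
definition complete_principal_seq ::
  "(('x \<Rightarrow> real) \<Rightarrow> ('x \<Rightarrow> real) \<Rightarrow> real) \<Rightarrow> ('x \<Rightarrow> real) set \<Rightarrow> ('x \<Rightarrow> real) set
    \<Rightarrow> (('x \<Rightarrow> real) \<times> ('x \<Rightarrow> real)) list \<Rightarrow> bool" where
  "complete_principal_seq ip U V ps \<longleftrightarrow> principal_seq ip U V ps \<and>
     ((\<not> (\<exists>u\<in>U. ip u u = 1 \<and> (\<forall>p\<in>set ps. ip u (fst p) = 0))) \<or>
      (\<not> (\<exists>v\<in>V. ip v v = 1 \<and> (\<forall>p\<in>set ps. ip v (snd p) = 0))))"

text \<open>Principal angle of a pair: cos theta = |<u,v>|.\<close>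
definition pangle :: "(('x \<Rightarrow> real) \<Rightarrow> ('x \<Rightarrow> real) \<Rightarrow> real) \<Rightarrow> ('x \<Rightarrow> real) \<times> ('x \<Rightarrow> real) \<Rightarrow> real" where
  "pangle ip p = arccos \<bar>ip (fst p) (snd p)\<bar>"

text \<open>Orthogonal complement of span{w} within S.\<close>
definition remove_dir :: "(('x \<Rightarrow> real) \<Rightarrow> ('x \<Rightarrow> real) \<Rightarrow> real) \<Rightarrow> ('x \<Rightarrow> real) set \<Rightarrow> ('x \<Rightarrow> real) \<Rightarrow> ('x \<Rightarrow> real) set" where
  "remove_dir ip S w = {f\<in>S. ip f w = 0}"

end

theory Submission
  imports Defs
begin

text \<open>Sampling an observable at the data points, scaled by \<open>1 / \<surd>N\<close>, turns the empirical
  inner product into the Euclidean one and maps \<open>S\<^sub>k\<close> onto \<open>range A\<close> and \<open>K S\<^sub>k\<close> onto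
  \<open>range B\<close>, so everything happens between two subspaces of \<open>\<real>\<^sup>N\<close> of equal dimension.
  There \<open>A A\<^sup>\<dagger>\<close> and \<open>B B\<^sup>\<dagger>\<close> are the orthogonal projections \<open>P\<^sub>A, P\<^sub>B\<close>, and
  \<open>A M\<^sub>c a = (I - P\<^sub>A P\<^sub>B) A a\<close>: eigenpairs of \<open>M\<^sub>c\<close> are eigenpairs of \<open>I - P\<^sub>A P\<^sub>B\<close> on
  \<open>range A\<close>.

  The last pair \<open>(u, v)\<close> of a complete principal sequence is cross-orthogonal, which gives
  \<open>P\<^sub>A P\<^sub>B u = cos\<^sup>2 \<theta>\<^sub>m\<^sub>a\<^sub>x u\<close>; moreover every unit vector of \<open>range A\<close> has cosine at least
  \<open>cos \<theta>\<^sub>m\<^sub>a\<^sub>x\<close> with some unit vector of \<open>range B\<close>, and a Rayleigh-quotient argument turns this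
  into a lower bound \<open>cos\<^sup>2 \<theta>\<^sub>m\<^sub>a\<^sub>x\<close> on the eigenvalues of \<open>P\<^sub>A P\<^sub>B\<close> on \<open>range A\<close>.  Hence
  \<open>\<lambda>\<^sub>m\<^sub>a\<^sub>x = 1 - cos\<^sup>2 \<theta>\<^sub>m\<^sub>a\<^sub>x\<close>.  Conversely the normalized vector \<open>A v\<^sub>m\<^sub>a\<^sub>x\<close> has a partner in
  \<open>range B\<close> with the same two properties, and every such pair is the last pair of some complete
  principal sequence, built from the front by choosing maximal pairs in the orthogonal
  complements of the pair.\<close>

section \<open>Principal vectors of two subspaces\<close>

definition perp_in :: "'a::real_inner set \<Rightarrow> 'a \<Rightarrow> 'a set" where
  "perp_in U e = {x\<in>U. inner x e = 0}"

definition admissible_vecs :: "'a::real_inner set \<Rightarrow> 'a set \<Rightarrow> ('a \<times> 'a) list \<Rightarrow> 'a \<Rightarrow> 'a \<Rightarrow> bool" where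
  "admissible_vecs U V prev u v \<longleftrightarrow> u \<in> U \<and> v \<in> V \<and> inner u u = 1 \<and> inner v v = 1 \<and>
     (\<forall>p\<in>set prev. inner u (fst p) = 0 \<and> inner v (snd p) = 0)"

definition principal_vecs :: "'a::real_inner set \<Rightarrow> 'a set \<Rightarrow> ('a \<times> 'a) list \<Rightarrow> bool" where
  "principal_vecs U V ps \<longleftrightarrow>
     (\<forall>j<length ps. admissible_vecs U V (take j ps) (fst (ps ! j)) (snd (ps ! j)) \<and>
        (\<forall>u v. admissible_vecs U V (take j ps) u v \<longrightarrow>
                 \<bar>inner u v\<bar> \<le> \<bar>inner (fst (ps ! j)) (snd (ps ! j))\<bar>))"

definition complete_principal_vecs :: "'a::real_inner set \<Rightarrow> 'a set \<Rightarrow> ('a \<times> 'a) list \<Rightarrow> bool" where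
  "complete_principal_vecs U V ps \<longleftrightarrow> principal_vecs U V ps \<and>
     (\<not> (\<exists>u\<in>U. inner u u = 1 \<and> (\<forall>p\<in>set ps. inner u (fst p) = 0)) \<or>
      \<not> (\<exists>v\<in>V. inner v v = 1 \<and> (\<forall>p\<in>set ps. inner v (snd p) = 0)))"

definition max_cos_pair :: "'a::real_inner set \<Rightarrow> 'a set \<Rightarrow> 'a \<Rightarrow> 'a \<Rightarrow> bool" where
  "max_cos_pair U V u0 v0 \<longleftrightarrow> u0 \<in> U \<and> v0 \<in> V \<and> inner u0 u0 = 1 \<and> inner v0 v0 = 1 \<and>
     (\<forall>u\<in>U. \<forall>v\<in>V. inner u u = 1 \<longrightarrow> inner v v = 1 \<longrightarrow> \<bar>inner u v\<bar> \<le> \<bar>inner u0 v0\<bar>)"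

text \<open>\<open>cos_angles_ge U V c\<close> says that \<open>c \<le> cos \<theta>\<^sub>m\<^sub>a\<^sub>x\<close>: every unit vector of \<open>U\<close> makes an
  angle with cosine at least \<open>c\<close> with some unit vector of \<open>V\<close>.\<close>
definition cos_angles_ge :: "'a::real_inner set \<Rightarrow> 'a set \<Rightarrow> real \<Rightarrow> bool" where
  "cos_angles_ge U V c \<longleftrightarrow> (\<forall>u\<in>U. inner u u = 1 \<longrightarrow> (\<exists>v\<in>V. inner v v = 1 \<and> c \<le> \<bar>inner u v\<bar>))"

text \<open>The pairs occurring last in complete principal sequences: the projection of \<open>u\<close> onto \<open>V\<close>
  is parallel to \<open>v\<close>, that of \<open>v\<close> onto \<open>U\<close> is parallel to \<open>u\<close>, and \<open>\<bar>\<langle>u, v\<rangle>\<bar> = cos \<theta>\<^sub>m\<^sub>a\<^sub>x\<close>.\<close>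
definition largest_angle_pair :: "'a::real_inner set \<Rightarrow> 'a set \<Rightarrow> 'a \<Rightarrow> 'a \<Rightarrow> bool" where
  "largest_angle_pair U V u v \<longleftrightarrow> u \<in> U \<and> v \<in> V \<and> inner u u = 1 \<and> inner v v = 1 \<and>
     (\<forall>y\<in>perp_in V v. inner u y = 0) \<and> (\<forall>x\<in>perp_in U u. inner v x = 0) \<and>
     cos_angles_ge U V \<bar>inner u v\<bar>"

lemma admissible_vecs_Cons:
  "admissible_vecs U V (p # prev) u v \<longleftrightarrow>
   admissible_vecs (perp_in U (fst p)) (perp_in V (snd p)) prev u v"
  by (auto simp: admissible_vecs_def perp_in_def)

lemma admissible_vecs_Nil:
  "admissible_vecs U V [] u v \<longleftrightarrow> u \<in> U \<and> v \<in> V \<and> inner u u = 1 \<and> inner v v = 1"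
  by (simp add: admissible_vecs_def)

lemma principal_vecs_Cons:
  "principal_vecs U V (p # ps) \<longleftrightarrow>
   max_cos_pair U V (fst p) (snd p) \<and> principal_vecs (perp_in U (fst p)) (perp_in V (snd p)) ps"
  unfolding principal_vecs_def length_Cons All_less_Suc2
  by (auto simp: admissible_vecs_Cons admissible_vecs_Nil max_cos_pair_def)

lemma complete_principal_vecs_Cons:
  "complete_principal_vecs U V (p # ps) \<longleftrightarrow>
   max_cos_pair U V (fst p) (snd p) \<and>
   complete_principal_vecs (perp_in U (fst p)) (perp_in V (snd p)) ps"
  unfolding complete_principal_vecs_def principal_vecs_Cons by (auto simp: perp_in_def)

lemma complete_principal_vecs_Nil:
  "complete_principal_vecs U V [] \<longleftrightarrow> \<not> (\<exists>u\<in>U. inner u u = 1) \<or> \<not> (\<exists>v\<in>V. inner v v = 1)"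
  by (simp add: complete_principal_vecs_def principal_vecs_def)

lemma principal_vecs_mem:
  assumes "principal_vecs U V ps" "q \<in> set ps"
  shows "fst q \<in> U \<and> snd q \<in> V \<and> inner (fst q) (fst q) = 1 \<and> inner (snd q) (snd q) = 1"
  using assms by (auto simp: principal_vecs_def admissible_vecs_def in_set_conv_nth)

lemma principal_vecs_abs_inner_le_1:
  "principal_vecs U V ps \<Longrightarrow> q \<in> set ps \<Longrightarrow> \<bar>inner (fst q) (snd q)\<bar> \<le> 1"
  using principal_vecs_mem Cauchy_Schwarz_ineq2[of "fst q" "snd q"] by (fastforce simp: norm_eq_1[symmetric])

lemma principal_vecs_cos_antimono:
  assumes "principal_vecs U V ps" "i \<le> j" "j < length ps"
  shows "\<bar>inner (fst (ps ! j)) (snd (ps ! j))\<bar> \<le> \<bar>inner (fst (ps ! i)) (snd (ps ! i))\<bar>"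
proof -
  have "admissible_vecs U V (take j ps) (fst (ps ! j)) (snd (ps ! j))"
    using assms unfolding principal_vecs_def by auto
  moreover have "set (take i ps) \<subseteq> set (take j ps)"
    using assms(2) by (rule set_take_subset_set_take)
  ultimately have "admissible_vecs U V (take i ps) (fst (ps ! j)) (snd (ps ! j))"
    by (auto simp: admissible_vecs_def)
  then show ?thesis
    using assms unfolding principal_vecs_def by auto
qed

lemma principal_vecs_arccos_le_last:
  assumes "principal_vecs U V ps" "q \<in> set ps"
  shows "arccos \<bar>inner (fst q) (snd q)\<bar> \<le> arccos \<bar>inner (fst (last ps)) (snd (last ps))\<bar>"
proof -
  obtain i where i: "i < length ps" "q = ps ! i"
    using assms(2) by (auto simp: in_set_conv_nth)
  have "ps \<noteq> []"
    using i by auto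
  then have last: "last ps = ps ! (length ps - 1)"
    by (rule last_conv_nth)
  have "\<bar>inner (fst q) (snd q)\<bar> \<le> 1"
    using principal_vecs_abs_inner_le_1[OF assms] .
  moreover have "\<bar>inner (fst (last ps)) (snd (last ps))\<bar> \<le> \<bar>inner (fst q) (snd q)\<bar>"
    using principal_vecs_cos_antimono[OF assms(1), of i "length ps - 1"] i last by simp
  ultimately show ?thesis
    by (intro arccos_le_arccos) auto
qed

lemma unit_sgn: "x \<noteq> 0 \<Longrightarrow> inner (sgn x) (sgn x) = (1::real)"
  by (simp add: norm_eq_1[symmetric] norm_sgn)

lemma sgn_in_subspace: "subspace U \<Longrightarrow> x \<in> U \<Longrightarrow> sgn (x::'a::real_normed_vector) \<in> U"
  using subspace_scale[of U x "inverse (norm x)"] by (simp add: sgn_div_norm)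

lemma subspace_perp_in: "subspace U \<Longrightarrow> subspace (perp_in U e)"
  by (auto simp: subspace_def perp_in_def inner_add_left)

lemma dim_perp_in:
  fixes U :: "'a::euclidean_space set"
  assumes "subspace U" "e \<in> U" "e \<noteq> 0"
  shows "dim (perp_in U e) = dim U - 1"
proof -
  have eq: "perp_in U e = {y\<in>U. \<forall>x\<in>span {e}. orthogonal x y}"
    by (auto simp: perp_in_def span_singleton orthogonal_def inner_commute)
  have "span {e} \<subseteq> U"
    using assms by (simp add: span_minimal)
  from dim_subspace_orthogonal_to_vectors[OF subspace_span assms(1) this]
  show ?thesis
    using assms(3) by (simp add: eq)
qed

lemma exists_unit_iff_dim:
  fixes U :: "'a::euclidean_space set"
  assumes "subspace U"
  shows "(\<exists>u\<in>U. inner u u = 1) \<longleftrightarrow> dim U \<noteq> 0"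
proof
  assume "dim U \<noteq> 0"
  then obtain x where "x \<in> U" "x \<noteq> 0"
    by (auto simp: dim_eq_0)
  then show "\<exists>u\<in>U. inner u u = 1"
    using sgn_in_subspace[OF assms] unit_sgn by blast
qed (auto simp: dim_eq_0)

lemma diff_proj_in_perp_in:
  assumes "subspace U" "u \<in> U" "e \<in> U" "inner e e = 1"
  shows "u - inner u e *\<^sub>R e \<in> perp_in U e"
  using assms by (simp add: perp_in_def subspace_diff subspace_scale inner_diff_left)

lemma inner_self_proj_decomp:
  assumes "inner e e = 1"
  shows "inner u u = (inner u e)\<^sup>2 + inner (u - inner u e *\<^sub>R e) (u - inner u e *\<^sub>R e)"
  using assms by (simp add: inner_diff_left inner_diff_right inner_commute power2_eq_square)

lemma norm_diff_proj_le_1: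
  assumes "inner e e = 1" "inner v v = 1"
  shows "norm (v - inner v e *\<^sub>R e) \<le> 1"
proof -
  have "(norm (v - inner v e *\<^sub>R e))\<^sup>2 = 1 - (inner v e)\<^sup>2"
    using inner_self_proj_decomp[OF assms(1), of v] assms(2) by (simp add: power2_norm_eq_inner)
  then have "(norm (v - inner v e *\<^sub>R e))\<^sup>2 \<le> 1"
    by simp
  then show ?thesis
    by (simp add: power_le_one_iff abs_le_square_iff[symmetric])
qed

text \<open>The first-order condition at \<open>t = 0\<close> for a maximum of the squared cosine.\<close>
lemma affine_square_bound_imp_zero:
  fixes d e K :: real
  assumes bound: "\<And>t. (d + t * e)\<^sup>2 \<le> d\<^sup>2 * (1 + t\<^sup>2 * K)" and "K \<ge> 0"
  shows "e = 0"
proof (rule ccontr)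
  assume "e \<noteq> 0"
  show False
  proof (cases "d = 0")
    case True
    with bound[of 1] \<open>e \<noteq> 0\<close> show False by simp
  next
    case False
    define s where "s = 1 / (d\<^sup>2 * K + 1)"
    have "d\<^sup>2 * K \<ge> 0"
      using \<open>K \<ge> 0\<close> by simp
    then have "s > 0" and "s * (d\<^sup>2 * K) < 1"
      by (simp_all add: s_def divide_less_eq_1_pos)
    have "(d + (s * d * e) * e)\<^sup>2 - d\<^sup>2 * (1 + (s * d * e)\<^sup>2 * K)
          = (s * d\<^sup>2 * e\<^sup>2) * (2 + s * e\<^sup>2 - s * (d\<^sup>2 * K))"
      by (simp add: power2_eq_square algebra_simps)
    also have "\<dots> > 0"
    proof (rule mult_pos_pos)
      show "s * d\<^sup>2 * e\<^sup>2 > 0"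
        using \<open>s > 0\<close> False \<open>e \<noteq> 0\<close> by simp
      have "s * e\<^sup>2 \<ge> 0"
        using \<open>s > 0\<close> by simp
      then show "2 + s * e\<^sup>2 - s * (d\<^sup>2 * K) > 0"
        using \<open>s * (d\<^sup>2 * K) < 1\<close> by linarith
    qed
    finally show False
      using bound[of "s * d * e"] by simp
  qed
qed

lemma max_cos_pair_sym: "max_cos_pair U V u0 v0 \<Longrightarrow> max_cos_pair V U v0 u0"
  unfolding max_cos_pair_def by (metis inner_commute)

lemma max_cos_pair_bound:
  assumes "subspace U" "subspace V" "max_cos_pair U V u0 v0" "x \<in> U" "y \<in> V"
  shows "\<bar>inner x y\<bar> \<le> \<bar>inner u0 v0\<bar> * norm x * norm y"
proof (cases "x = 0 \<or> y = 0")
  case False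
  then have "\<bar>inner (sgn x) (sgn y)\<bar> \<le> \<bar>inner u0 v0\<bar>"
    using assms(3) sgn_in_subspace[OF assms(1,4)] sgn_in_subspace[OF assms(2,5)] unit_sgn[of x]
      unit_sgn[of y] by (auto simp: max_cos_pair_def)
  moreover have "inner (sgn x) (sgn y) = inner x y / (norm x * norm y)"
    by (simp add: sgn_div_norm divide_inverse)
  ultimately show ?thesis
    using False by (simp add: abs_mult divide_le_eq mult.assoc)
qed auto

text \<open>A maximizing pair is cross-orthogonal: tilting \<open>u0\<close> towards an orthogonal \<open>u\<close> cannot
  increase the cosine, which forces \<open>\<langle>u, v0\<rangle> = 0\<close>.\<close>
lemma max_cos_pair_orthogonal:
  assumes "subspace U" and max: "max_cos_pair U V u0 v0" and "u \<in> U" "inner u u0 = 0"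
  shows "inner u v0 = 0"
proof -
  have u0: "u0 \<in> U" "inner u0 u0 = 1" and v0: "v0 \<in> V" "inner v0 v0 = 1"
    using max by (auto simp: max_cos_pair_def)
  define d where "d = inner u0 v0"
  define e where "e = inner u v0"
  have "(d + t * e)\<^sup>2 \<le> d\<^sup>2 * (1 + t\<^sup>2 * inner u u)" for t
  proof -
    define w where "w = u0 + t *\<^sub>R u"
    have ww: "inner w w = 1 + t\<^sup>2 * inner u u"
      using assms(4) u0 by (simp add: w_def inner_add_left inner_add_right inner_commute power2_eq_square)
    then have "w \<noteq> 0"
      using add_pos_nonneg[of 1 "t\<^sup>2 * inner u u"] by auto
    moreover have "w \<in> U"
      using assms(1,3) u0 by (simp add: w_def subspace_add subspace_scale)
    ultimately have "\<bar>inner (sgn w) v0\<bar> \<le> \<bar>d\<bar>"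
      using max v0 sgn_in_subspace[OF assms(1)] unit_sgn by (auto simp: max_cos_pair_def d_def)
    moreover have "inner (sgn w) v0 = (d + t * e) / norm w"
      by (simp add: sgn_div_norm divide_inverse w_def d_def e_def inner_add_left)
    ultimately have "\<bar>d + t * e\<bar> \<le> \<bar>d\<bar> * norm w"
      using \<open>w \<noteq> 0\<close> by (simp add: divide_le_eq)
    then have "(d + t * e)\<^sup>2 \<le> (\<bar>d\<bar> * norm w)\<^sup>2"
      by (simp add: abs_le_square_iff[symmetric])
    then show ?thesis
      using ww by (simp add: power_mult_distrib power2_norm_eq_inner)
  qed
  then show ?thesis
    unfolding e_def by (rule affine_square_bound_imp_zero) simp
qed

lemma max_cos_pair_orthogonal':
  assumes "subspace V" "max_cos_pair U V u0 v0" "v \<in> V" "inner v v0 = 0"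
  shows "inner u0 v = 0"
  using max_cos_pair_orthogonal[OF assms(1) max_cos_pair_sym[OF assms(2)] assms(3,4)]
  by (simp add: inner_commute)

lemma max_cos_pair_exists:
  fixes U V :: "'a::euclidean_space set"
  assumes "subspace U" "subspace V" "\<exists>u\<in>U. inner u u = 1" "\<exists>v\<in>V. inner v v = 1"
  shows "\<exists>u0 v0. max_cos_pair U V u0 v0"
proof -
  let ?S = "(U \<inter> sphere 0 1) \<times> (V \<inter> sphere 0 1)"
  have "compact ?S"
    using assms by (intro compact_Times closed_Int_compact closed_subspace compact_sphere)
  moreover have "?S \<noteq> {}"
    using assms(3,4) by (auto simp: norm_eq_1)
  moreover have "continuous_on ?S (\<lambda>p. \<bar>inner (fst p) (snd p)\<bar>)"
    by (intro continuous_intros)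
  ultimately obtain p where "p \<in> ?S" and "\<forall>q\<in>?S. \<bar>inner (fst q) (snd q)\<bar> \<le> \<bar>inner (fst p) (snd p)\<bar>"
    using continuous_attains_sup by blast
  then have "max_cos_pair U V (fst p) (snd p)"
    by (auto simp: max_cos_pair_def mem_Times_iff norm_eq_1[symmetric])
  then show ?thesis
    by blast
qed

lemma exists_unit_inner_ge_norm2:
  assumes "subspace V" "v0 \<in> V" "v1 \<in> V" "inner v0 v0 = 1" "inner v1 v1 = 1" "inner v0 v1 = 0"
  shows "\<exists>v\<in>V. inner v v = 1 \<and> sqrt ((inner u v0)\<^sup>2 + (inner u v1)\<^sup>2) \<le> \<bar>inner u v\<bar>"
proof (cases "(inner u v0)\<^sup>2 + (inner u v1)\<^sup>2 = 0")
  case True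
  then show ?thesis
    using assms(2,4) by auto
next
  case False
  then have pos: "(inner u v0)\<^sup>2 + (inner u v1)\<^sup>2 > 0"
    using zero_le_power2[of "inner u v0"] zero_le_power2[of "inner u v1"] by linarith
  define r where "r = sqrt ((inner u v0)\<^sup>2 + (inner u v1)\<^sup>2)"
  have "r > 0" and r2: "r\<^sup>2 = (inner u v0)\<^sup>2 + (inner u v1)\<^sup>2"
    using pos by (simp_all add: r_def)
  define v where "v = (inner u v0 / r) *\<^sub>R v0 + (inner u v1 / r) *\<^sub>R v1"
  have "v \<in> V"
    using assms(1-3) by (simp add: v_def subspace_add subspace_scale)
  moreover have "inner v v = ((inner u v0)\<^sup>2 + (inner u v1)\<^sup>2) / r\<^sup>2"
    using assms(4-6) by (simp add: v_def inner_add_left inner_add_right inner_commute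
        power2_eq_square add_divide_distrib)
  moreover have "inner u v = r\<^sup>2 / r"
    using r2 by (simp add: v_def inner_add_right power2_eq_square add_divide_distrib)
  ultimately have "v \<in> V \<and> inner v v = 1 \<and> inner u v = r"
    using \<open>r > 0\<close> r2 False by (simp add: power2_eq_square)
  then show ?thesis
    unfolding r_def by (metis abs_ge_self)
qed

text \<open>The inductive step for \<open>cos_angles_ge\<close>: a unit \<open>u = a u0 + u'\<close> is matched against a
  combination of \<open>v0\<close> and the partner \<open>v'\<close> of \<open>sgn u'\<close> in the complements.\<close>
lemma cos_angles_ge_perp_in_step:
  fixes U V :: "'a::euclidean_space set"
  assumes "subspace U" "subspace V" and max: "max_cos_pair U V u0 v0"
    and perp: "cos_angles_ge (perp_in U u0) (perp_in V v0) c" and "c \<le> \<bar>inner u0 v0\<bar>"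
  shows "cos_angles_ge U V c"
  unfolding cos_angles_ge_def
proof (intro ballI impI)
  fix u assume "u \<in> U" "inner u u = 1"
  have u0: "u0 \<in> U" "inner u0 u0 = 1" and v0: "v0 \<in> V" "inner v0 v0 = 1"
    using max by (auto simp: max_cos_pair_def)
  define a where "a = inner u u0"
  define u' where "u' = u - a *\<^sub>R u0"
  have u'_perp: "u' \<in> perp_in U u0"
    unfolding u'_def a_def using diff_proj_in_perp_in[OF assms(1) \<open>u \<in> U\<close> u0] .
  have norm: "a\<^sup>2 + (norm u')\<^sup>2 = 1"
    using inner_self_proj_decomp[OF u0(2), of u] \<open>inner u u = 1\<close>
    by (simp add: a_def u'_def power2_norm_eq_inner)
  have "inner u' v0 = 0"
    using u'_perp max_cos_pair_orthogonal[OF assms(1) max] by (simp add: perp_in_def)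
  then have uv0: "inner u v0 = a * inner u0 v0"
    by (simp add: u'_def inner_diff_left)
  show "\<exists>v\<in>V. inner v v = 1 \<and> c \<le> \<bar>inner u v\<bar>"
  proof (cases "c \<le> 0 \<or> u' = 0")
    case True
    then consider "c \<le> 0" | "\<bar>a\<bar> = 1"
      using norm by (auto simp: power2_eq_1_iff)
    then have "c \<le> \<bar>inner u v0\<bar>"
      using \<open>c \<le> \<bar>inner u0 v0\<bar>\<close> uv0 by cases (auto simp: abs_mult intro: order_trans)
    then show ?thesis
      using v0 by blast
  next
    case False
    then obtain v' where v': "v' \<in> perp_in V v0" "inner v' v' = 1" "c \<le> \<bar>inner (sgn u') v'\<bar>"
      using perp sgn_in_subspace[OF subspace_perp_in[OF assms(1)] u'_perp] unit_sgn
      unfolding cos_angles_ge_def by blast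
    then have "inner u0 v' = 0"
      using max_cos_pair_orthogonal'[OF assms(2) max] by (simp add: perp_in_def)
    then have uv': "inner u v' = norm u' * inner (sgn u') v'"
      using False by (simp add: u'_def inner_diff_left sgn_div_norm)
    have "c\<^sup>2 = a\<^sup>2 * c\<^sup>2 + (norm u')\<^sup>2 * c\<^sup>2"
      using norm by algebra
    also have "\<dots> \<le> (inner u v0)\<^sup>2 + (inner u v')\<^sup>2"
      using False \<open>c \<le> \<bar>inner u0 v0\<bar>\<close> v'(3) unfolding uv0 uv' power_mult_distrib
      by (intro add_mono mult_left_mono) (auto simp: abs_le_square_iff[symmetric] power2_abs)
    finally have c_le: "c \<le> sqrt ((inner u v0)\<^sup>2 + (inner u v')\<^sup>2)"
      using real_le_rsqrt by blast
    have "v' \<in> V" "inner v0 v' = 0"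
      using v'(1) by (auto simp: perp_in_def inner_commute)
    then obtain v where "v \<in> V" "inner v v = 1" "sqrt ((inner u v0)\<^sup>2 + (inner u v')\<^sup>2) \<le> \<bar>inner u v\<bar>"
      using exists_unit_inner_ge_norm2[OF assms(2) v0(1) _ v0(2) v'(2)] by blast
    with c_le show ?thesis
      by (meson order_trans)
  qed
qed

lemma orthogonal_perp_in_lift:
  assumes "subspace V" "v0 \<in> V" "inner v0 v0 = 1" "inner u v0 = 0" "inner v v0 = 0"
    and "\<forall>y\<in>perp_in (perp_in V v0) v. inner u y = 0"
  shows "\<forall>y\<in>perp_in V v. inner u y = 0"
proof
  fix y assume "y \<in> perp_in V v"
  define y' where "y' = y - inner y v0 *\<^sub>R v0"
  have "y' \<in> perp_in V v0"
    using diff_proj_in_perp_in[OF assms(1) _ assms(2,3)] \<open>y \<in> perp_in V v\<close>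
    by (simp add: y'_def perp_in_def)
  moreover have "inner y' v = 0"
    using \<open>y \<in> perp_in V v\<close> assms(5)
    by (simp add: y'_def perp_in_def inner_diff_left inner_commute[of v0 v])
  ultimately have "inner u y' = 0"
    using assms(6) by (simp add: perp_in_def)
  then show "inner u y = 0"
    using assms(4) by (simp add: y'_def inner_diff_right)
qed

lemma largest_angle_pair_lift:
  fixes U V :: "'a::euclidean_space set"
  assumes "subspace U" "subspace V" and max: "max_cos_pair U V u0 v0"
    and pair: "largest_angle_pair (perp_in U u0) (perp_in V v0) u v"
  shows "largest_angle_pair U V u v"
proof -
  have u0: "u0 \<in> U" "inner u0 u0 = 1" and v0: "v0 \<in> V" "inner v0 v0 = 1"
    using max by (auto simp: max_cos_pair_def)
  have u: "u \<in> U" "inner u u0 = 0" "inner u u = 1" and v: "v \<in> V" "inner v v0 = 0" "inner v v = 1"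
    using pair by (auto simp: largest_angle_pair_def perp_in_def)
  have "inner u v0 = 0" "inner v u0 = 0"
    using max_cos_pair_orthogonal[OF assms(1) max u(1,2)]
      max_cos_pair_orthogonal'[OF assms(2) max v(1,2)] by (simp_all add: inner_commute)
  then have "\<forall>y\<in>perp_in V v. inner u y = 0" "\<forall>x\<in>perp_in U u. inner v x = 0"
    using pair u v orthogonal_perp_in_lift[OF assms(2) v0, of u v]
      orthogonal_perp_in_lift[OF assms(1) u0, of v u]
    by (simp_all add: largest_angle_pair_def)
  moreover have "cos_angles_ge U V \<bar>inner u v\<bar>"
    using cos_angles_ge_perp_in_step[OF assms(1,2) max] pair u v max
    by (simp add: largest_angle_pair_def max_cos_pair_def)
  ultimately show ?thesis
    using u v by (simp add: largest_angle_pair_def)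
qed

lemma largest_angle_pair_dim_1:
  fixes U V :: "'a::euclidean_space set"
  assumes "subspace U" "subspace V" "dim U = 1" and max: "max_cos_pair U V u0 v0"
  shows "largest_angle_pair U V u0 v0"
proof -
  have u0: "u0 \<in> U" "inner u0 u0 = 1" and v0: "v0 \<in> V" "inner v0 v0 = 1"
    using max by (auto simp: max_cos_pair_def)
  have "u0 \<noteq> 0"
    using u0(2) by auto
  then have "dim (perp_in U u0) = 0"
    using dim_perp_in[OF assms(1) u0(1)] assms(3) by (simp del: dim_eq_0)
  then have "\<not> (\<exists>x\<in>perp_in U u0. inner x x = 1)"
    using exists_unit_iff_dim[OF subspace_perp_in[OF assms(1)]] by blast
  then have "cos_angles_ge (perp_in U u0) (perp_in V v0) \<bar>inner u0 v0\<bar>"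
    by (auto simp: cos_angles_ge_def)
  then have "cos_angles_ge U V \<bar>inner u0 v0\<bar>"
    using cos_angles_ge_perp_in_step[OF assms(1,2) max] by simp
  moreover have "\<forall>y\<in>perp_in V v0. inner u0 y = 0" "\<forall>x\<in>perp_in U u0. inner v0 x = 0"
    using max_cos_pair_orthogonal[OF assms(1) max] max_cos_pair_orthogonal'[OF assms(2) max]
    by (auto simp: perp_in_def inner_commute)
  ultimately show ?thesis
    using u0 v0 by (simp add: largest_angle_pair_def)
qed

lemma complete_principal_vecs_length:
  fixes U V :: "'a::euclidean_space set"
  assumes "subspace U" "subspace V" "dim U = dim V" "complete_principal_vecs U V ps"
  shows "length ps = dim U"
  using assms
proof (induction ps arbitrary: U V)
  case Nil
  then show ?case
    by (metis complete_principal_vecs_Nil exists_unit_iff_dim list.size(3))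
next
  case (Cons p ps)
  have max: "max_cos_pair U V (fst p) (snd p)"
    and rest: "complete_principal_vecs (perp_in U (fst p)) (perp_in V (snd p)) ps"
    using Cons.prems(4) by (simp_all add: complete_principal_vecs_Cons)
  then have "fst p \<in> U" "fst p \<noteq> 0" "snd p \<in> V" "snd p \<noteq> 0" "dim U \<noteq> 0"
    using exists_unit_iff_dim[OF Cons.prems(1)] by (auto simp: max_cos_pair_def)
  then show ?case
    using Cons.IH[OF subspace_perp_in subspace_perp_in _ rest] Cons.prems(1-3)
      dim_perp_in[OF Cons.prems(1)] dim_perp_in[OF Cons.prems(2)] by (simp del: dim_eq_0)
qed

lemma complete_principal_vecs_last:
  fixes U V :: "'a::euclidean_space set"
  assumes "subspace U" "subspace V" "dim U = dim V" "complete_principal_vecs U V ps" "ps \<noteq> []"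
  shows "largest_angle_pair U V (fst (last ps)) (snd (last ps))"
  using assms
proof (induction ps arbitrary: U V)
  case (Cons p ps)
  have max: "max_cos_pair U V (fst p) (snd p)"
    and rest: "complete_principal_vecs (perp_in U (fst p)) (perp_in V (snd p)) ps"
    using Cons.prems(4) by (simp_all add: complete_principal_vecs_Cons)
  then have "fst p \<in> U" "fst p \<noteq> 0" "snd p \<in> V" "snd p \<noteq> 0"
    by (auto simp: max_cos_pair_def)
  then have dims: "dim (perp_in U (fst p)) = dim (perp_in V (snd p))"
    using Cons.prems(1-3) dim_perp_in by metis
  show ?case
  proof (cases "ps = []")
    case True
    then have "dim U = 1"
      using complete_principal_vecs_length[OF Cons.prems(1-4)] by simp
    with True show ?thesis
      using largest_angle_pair_dim_1[OF Cons.prems(1,2) _ max] by simp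
  next
    case False
    then show ?thesis
      using Cons.IH[OF subspace_perp_in subspace_perp_in dims rest]
        largest_angle_pair_lift[OF Cons.prems(1,2) max] Cons.prems(1,2) by simp
  qed
qed simp

lemma complete_principal_vecs_exists:
  fixes U V :: "'a::euclidean_space set"
  assumes "subspace U" "subspace V" "dim U = dim V"
  shows "\<exists>ps. complete_principal_vecs U V ps"
  using assms
proof (induction "dim U" arbitrary: U V)
  case 0
  then show ?case
    using exists_unit_iff_dim complete_principal_vecs_Nil by metis
next
  case (Suc k)
  obtain u0 v0 where max: "max_cos_pair U V u0 v0"
    using max_cos_pair_exists[OF Suc.prems(1,2)] exists_unit_iff_dim Suc by (metis nat.distinct(1))
  then have "u0 \<in> U" "u0 \<noteq> 0" "v0 \<in> V" "v0 \<noteq> 0"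
    by (auto simp: max_cos_pair_def)
  then have "dim (perp_in U u0) = k" "dim (perp_in V v0) = k"
    using dim_perp_in[OF Suc.prems(1)] dim_perp_in[OF Suc.prems(2)] Suc.hyps(2) Suc.prems(3)
    by (simp_all del: dim_eq_0)
  then obtain ps where "complete_principal_vecs (perp_in U u0) (perp_in V v0) ps"
    using Suc.hyps(1) Suc.prems(1,2) subspace_perp_in by (metis (no_types))
  then have "complete_principal_vecs U V ((u0, v0) # ps)"
    using max by (simp add: complete_principal_vecs_Cons)
  then show ?case
    by blast
qed

lemma abs_mult_add_abs_mult_le_1:
  fixes a b x y :: real
  assumes "a\<^sup>2 + x\<^sup>2 = 1" "b\<^sup>2 + y\<^sup>2 = 1"
  shows "\<bar>a\<bar> * \<bar>b\<bar> + \<bar>x\<bar> * \<bar>y\<bar> \<le> 1"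
  using sum_squares_bound[of "\<bar>a\<bar>" "\<bar>b\<bar>"] sum_squares_bound[of "\<bar>x\<bar>" "\<bar>y\<bar>"] assms by simp

text \<open>Splitting \<open>u = a us + u'\<close> and \<open>v = b vs + v'\<close>, cross-orthogonality kills the mixed terms.\<close>
lemma largest_angle_pair_inner_le:
  assumes "subspace U" "subspace V" and pair: "largest_angle_pair U V us vs"
    and "\<bar>inner us vs\<bar> \<le> R"
    and bound: "\<forall>x\<in>perp_in U us. \<forall>y\<in>perp_in V vs. \<bar>inner x y\<bar> \<le> R * norm x * norm y"
    and "u \<in> U" "v \<in> V" "inner u u = 1" "inner v v = 1"
  shows "\<bar>inner u v\<bar> \<le> R"
proof -
  have us: "us \<in> U" "inner us us = 1" and vs: "vs \<in> V" "inner vs vs = 1"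
    using pair by (auto simp: largest_angle_pair_def)
  define a where "a = inner u us"
  define b where "b = inner v vs"
  define u' where "u' = u - a *\<^sub>R us"
  define v' where "v' = v - b *\<^sub>R vs"
  have u': "u' \<in> perp_in U us" and v': "v' \<in> perp_in V vs"
    unfolding u'_def v'_def a_def b_def
    using diff_proj_in_perp_in[OF assms(1) \<open>u \<in> U\<close> us] diff_proj_in_perp_in[OF assms(2) \<open>v \<in> V\<close> vs] .
  have "inner us v' = 0" "inner vs u' = 0"
    using pair u' v' by (simp_all add: largest_angle_pair_def)
  then have "inner u v = a * b * inner us vs + inner u' v'"
    unfolding u'_def v'_def by (simp add: inner_diff_left inner_diff_right inner_commute algebra_simps)
  then have "\<bar>inner u v\<bar> \<le> \<bar>a * b * inner us vs\<bar> + \<bar>inner u' v'\<bar>"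
    by (simp only: abs_triangle_ineq)
  also have "\<dots> \<le> \<bar>a\<bar> * \<bar>b\<bar> * \<bar>inner us vs\<bar> + R * norm u' * norm v'"
    using bound u' v' by (simp add: abs_mult)
  also have "\<dots> \<le> \<bar>a\<bar> * \<bar>b\<bar> * R + R * norm u' * norm v'"
    using mult_left_mono[OF \<open>\<bar>inner us vs\<bar> \<le> R\<close>, of "\<bar>a\<bar> * \<bar>b\<bar>"] by simp
  also have "\<dots> = R * (\<bar>a\<bar> * \<bar>b\<bar> + \<bar>norm u'\<bar> * \<bar>norm v'\<bar>)"
    by (simp add: ring_distribs mult_ac)
  also have "\<dots> \<le> R"
    using inner_self_proj_decomp[OF us(2), of u] inner_self_proj_decomp[OF vs(2), of v]
      \<open>inner u u = 1\<close> \<open>inner v v = 1\<close> \<open>\<bar>inner us vs\<bar> \<le> R\<close>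
    by (intro mult_right_le_one_le abs_mult_add_abs_mult_le_1)
       (simp_all add: a_def b_def u'_def v'_def power2_norm_eq_inner)
  finally show ?thesis .
qed

lemma max_cos_pair_dim_1:
  fixes U V :: "'a::euclidean_space set"
  assumes "subspace U" "subspace V" "dim U = 1" and pair: "largest_angle_pair U V us vs"
  shows "max_cos_pair U V us vs"
proof -
  have us: "us \<in> U" "us \<noteq> 0"
    using pair by (auto simp: largest_angle_pair_def)
  then have "perp_in U us \<subseteq> {0}"
    using dim_perp_in[OF assms(1) us] assms(3) by simp
  then have bound: "\<forall>x\<in>perp_in U us. \<forall>y\<in>perp_in V vs. \<bar>inner x y\<bar> \<le> \<bar>inner us vs\<bar> * norm x * norm y"
    by auto
  have "\<bar>inner u v\<bar> \<le> \<bar>inner us vs\<bar>"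
    if "u \<in> U" "v \<in> V" "inner u u = 1" "inner v v = 1" for u v
    using largest_angle_pair_inner_le[OF assms(1,2) pair order_refl bound that] .
  then show ?thesis
    using pair by (simp add: max_cos_pair_def largest_angle_pair_def)
qed

lemma largest_angle_pair_cos_le:
  fixes U V :: "'a::euclidean_space set"
  assumes "subspace U" "subspace V" and pair: "largest_angle_pair U V us vs"
    and max: "max_cos_pair (perp_in U us) (perp_in V vs) u0 v0"
  shows "\<bar>inner us vs\<bar> \<le> \<bar>inner u0 v0\<bar>"
proof -
  have vs: "vs \<in> V" "inner vs vs = 1"
    using pair by (auto simp: largest_angle_pair_def)
  have u0: "u0 \<in> U" "inner u0 us = 0" "inner u0 u0 = 1"
    using max by (auto simp: max_cos_pair_def perp_in_def)
  then obtain v where v: "v \<in> V" "inner v v = 1" "\<bar>inner us vs\<bar> \<le> \<bar>inner u0 v\<bar>"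
    using pair by (auto simp: largest_angle_pair_def cos_angles_ge_def)
  define v' where "v' = v - inner v vs *\<^sub>R vs"
  have v': "v' \<in> perp_in V vs" "norm v' \<le> 1"
    unfolding v'_def using diff_proj_in_perp_in[OF assms(2) v(1) vs] norm_diff_proj_le_1[OF vs(2) v(2)] .
  have "inner u0 vs = 0"
    using pair u0 by (simp add: largest_angle_pair_def perp_in_def inner_commute)
  then have "\<bar>inner u0 v\<bar> = \<bar>inner u0 v'\<bar>"
    by (simp add: v'_def inner_diff_right)
  also have "\<dots> \<le> \<bar>inner u0 v0\<bar> * norm u0 * norm v'"
    using max_cos_pair_bound[OF subspace_perp_in subspace_perp_in max] assms(1,2) u0 v'(1)
    by (simp add: perp_in_def)
  also have "\<dots> \<le> \<bar>inner u0 v0\<bar>"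
    using u0(3) v'(2) by (simp add: norm_eq_1[symmetric] mult_left_le)
  finally show ?thesis
    using v(3) by linarith
qed

lemma max_cos_pair_of_perp_in:
  fixes U V :: "'a::euclidean_space set"
  assumes "subspace U" "subspace V" and pair: "largest_angle_pair U V us vs"
    and max: "max_cos_pair (perp_in U us) (perp_in V vs) u0 v0"
  shows "max_cos_pair U V u0 v0"
  using largest_angle_pair_inner_le[OF assms(1,2) pair largest_angle_pair_cos_le[OF assms]]
    max_cos_pair_bound[OF subspace_perp_in subspace_perp_in max] assms(1,2) max
  by (auto simp: max_cos_pair_def perp_in_def)

lemma cos_angles_ge_perp_in:
  assumes "subspace V" "v0 \<in> V" "inner v0 v0 = 1" and cos: "cos_angles_ge U V c"
    and "U' \<subseteq> U" "\<forall>u\<in>U'. inner u v0 = 0" "\<exists>w\<in>perp_in V v0. inner w w = 1"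
  shows "cos_angles_ge U' (perp_in V v0) c"
  unfolding cos_angles_ge_def
proof (intro ballI impI)
  fix u assume "u \<in> U'" "inner u u = 1"
  then obtain v where v: "v \<in> V" "inner v v = 1" "c \<le> \<bar>inner u v\<bar>"
    using cos assms(5) by (auto simp: cos_angles_ge_def)
  define v' where "v' = v - inner v v0 *\<^sub>R v0"
  have v': "v' \<in> perp_in V v0" "norm v' \<le> 1"
    unfolding v'_def using diff_proj_in_perp_in[OF assms(1) v(1) assms(2,3)]
      norm_diff_proj_le_1[OF assms(3) v(2)] .
  have uv': "inner u v' = inner u v"
    using assms(6) \<open>u \<in> U'\<close> by (simp add: v'_def inner_diff_right)
  show "\<exists>v\<in>perp_in V v0. inner v v = 1 \<and> c \<le> \<bar>inner u v\<bar>"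
  proof (cases "v' = 0")
    case True
    then show ?thesis
      using v(3) uv' assms(7) by auto
  next
    case False
    have "\<bar>inner u v\<bar> \<le> \<bar>inner u v\<bar> / norm v'"
      using v'(2) False by (simp add: le_divide_eq mult_left_le)
    also have "\<dots> = \<bar>inner u (sgn v')\<bar>"
      using uv' by (simp add: sgn_div_norm divide_inverse abs_mult)
    finally show ?thesis
      using v(3) sgn_in_subspace[OF subspace_perp_in[OF assms(1)] v'(1)] unit_sgn[OF False]
      by (meson order_trans)
  qed
qed

lemma largest_angle_pair_perp_in:
  assumes "subspace U" "subspace V" and pair: "largest_angle_pair U V us vs"
    and max: "max_cos_pair U V u0 v0" and "inner u0 us = 0" "inner v0 vs = 0"
  shows "largest_angle_pair (perp_in U u0) (perp_in V v0) us vs"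
proof -
  have "us \<in> perp_in U u0" "vs \<in> perp_in V v0"
    using pair assms(5,6) by (auto simp: largest_angle_pair_def perp_in_def inner_commute)
  moreover have "cos_angles_ge (perp_in U u0) (perp_in V v0) \<bar>inner us vs\<bar>"
    using max pair calculation max_cos_pair_orthogonal[OF assms(1) max]
    by (intro cos_angles_ge_perp_in[OF assms(2)])
       (auto simp: max_cos_pair_def largest_angle_pair_def perp_in_def)
  ultimately show ?thesis
    using pair by (auto simp: largest_angle_pair_def perp_in_def)
qed

text \<open>Maximal pairs of the complements of \<open>us\<close> and \<open>vs\<close> are maximal in \<open>U\<close> and \<open>V\<close> and leave
  \<open>(us, vs)\<close> a largest-angle pair of the smaller subspaces, so the sequence is built from the front.\<close>
lemma complete_principal_vecs_ending_in:
  fixes U V :: "'a::euclidean_space set"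
  assumes "subspace U" "subspace V" "dim U = dim V" "largest_angle_pair U V us vs"
  shows "\<exists>ps. complete_principal_vecs U V ps \<and> ps \<noteq> [] \<and> last ps = (us, vs)"
proof -
  have "dim U \<noteq> 0"
    using assms(4) exists_unit_iff_dim[OF assms(1)] by (auto simp: largest_angle_pair_def simp del: dim_eq_0)
  then obtain k where "dim U = Suc k"
    using not0_implies_Suc by blast
  then show ?thesis
    using assms
  proof (induction k arbitrary: U V)
    case 0
    have "us \<in> U" "us \<noteq> 0"
      using "0.prems"(5) by (auto simp: largest_angle_pair_def)
    then have "dim (perp_in U us) = 0"
      using dim_perp_in[OF "0.prems"(2)] "0.prems"(1) by (simp del: dim_eq_0)
    then have "\<not> (\<exists>u\<in>perp_in U us. inner u u = 1)"
      using exists_unit_iff_dim[OF subspace_perp_in[OF "0.prems"(2)]] by blast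
    then have "complete_principal_vecs U V [(us, vs)]"
      using max_cos_pair_dim_1 0 by (simp add: complete_principal_vecs_Cons complete_principal_vecs_Nil)
    then show ?case
      by auto
  next
    case (Suc k)
    have us: "us \<in> U" "us \<noteq> 0" and vs: "vs \<in> V" "vs \<noteq> 0"
      using Suc.prems(5) by (auto simp: largest_angle_pair_def)
    then have dims_us: "dim (perp_in U us) = Suc k" "dim (perp_in V vs) = Suc k"
      using Suc.prems(1,4) dim_perp_in[OF Suc.prems(2)] dim_perp_in[OF Suc.prems(3)]
      by (simp_all del: dim_eq_0)
    then have "\<exists>u\<in>perp_in U us. inner u u = 1" "\<exists>v\<in>perp_in V vs. inner v v = 1"
      using exists_unit_iff_dim[OF subspace_perp_in[OF Suc.prems(2)]]
        exists_unit_iff_dim[OF subspace_perp_in[OF Suc.prems(3)]] by (simp_all del: dim_eq_0)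
    then obtain u0 v0 where max: "max_cos_pair (perp_in U us) (perp_in V vs) u0 v0"
      using max_cos_pair_exists[OF subspace_perp_in[OF Suc.prems(2)] subspace_perp_in[OF Suc.prems(3)]]
      by blast
    then have "u0 \<in> perp_in U us" "inner u0 u0 = 1" "v0 \<in> perp_in V vs" "inner v0 v0 = 1"
      by (simp_all add: max_cos_pair_def)
    then have u0: "u0 \<in> U" "u0 \<noteq> 0" "inner u0 us = 0" and v0: "v0 \<in> V" "v0 \<noteq> 0" "inner v0 vs = 0"
      by (simp_all add: perp_in_def) (metis inner_zero_left zero_neq_one)+
    have max': "max_cos_pair U V u0 v0"
      using max_cos_pair_of_perp_in[OF Suc.prems(2,3,5) max] .
    have "dim (perp_in U u0) = Suc k" "dim (perp_in V v0) = Suc k"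
      using Suc.prems(1,4) dim_perp_in[OF Suc.prems(2) u0(1,2)] dim_perp_in[OF Suc.prems(3) v0(1,2)]
      by (simp_all del: dim_eq_0)
    then obtain ps where "complete_principal_vecs (perp_in U u0) (perp_in V v0) ps" "ps \<noteq> []"
        "last ps = (us, vs)"
      using Suc.IH[OF _ subspace_perp_in[OF Suc.prems(2)] subspace_perp_in[OF Suc.prems(3)] _
          largest_angle_pair_perp_in[OF Suc.prems(2,3,5) max' u0(3) v0(3)]] by auto
    then show ?case
      using max' by (intro exI[of _ "(u0, v0) # ps"]) (simp add: complete_principal_vecs_Cons)
  qed
qed

section \<open>Orthogonal projections\<close>

definition orthogonal_projection_onto :: "'a::real_inner set \<Rightarrow> ('a \<Rightarrow> 'a) \<Rightarrow> bool" where
  "orthogonal_projection_onto V P \<longleftrightarrow> (\<forall>w. P w \<in> V \<and> (\<forall>y\<in>V. inner (w - P w) y = 0))"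

lemma orthogonal_projection_onto_mem: "orthogonal_projection_onto V P \<Longrightarrow> P w \<in> V"
  unfolding orthogonal_projection_onto_def by blast

lemma orthogonal_projection_onto_inner:
  "orthogonal_projection_onto V P \<Longrightarrow> y \<in> V \<Longrightarrow> inner y (P w) = inner y w"
  unfolding orthogonal_projection_onto_def by (metis inner_commute inner_diff_left right_minus_eq)

lemma orthogonal_projection_onto_inner_self:
  "orthogonal_projection_onto V P \<Longrightarrow> inner w (P w) = (norm (P w))\<^sup>2"
  using orthogonal_projection_onto_inner[of V P "P w" w] orthogonal_projection_onto_mem[of V P w]
  by (simp add: inner_commute power2_norm_eq_inner)

lemma orthogonal_projection_onto_unique:
  assumes "subspace V" "orthogonal_projection_onto V P" "z \<in> V" "\<forall>y\<in>V. inner (w - z) y = 0"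
  shows "P w = z"
proof -
  have "P w - z \<in> V"
    using assms(1,3) orthogonal_projection_onto_mem[OF assms(2)] by (simp add: subspace_diff)
  have "P w - z = (w - z) - (w - P w)"
    by simp
  then have "inner (P w - z) (P w - z) = inner (w - z) (P w - z) - inner (w - P w) (P w - z)"
    by (metis inner_diff_left)
  also have "\<dots> = 0"
    using assms(2,4) \<open>P w - z \<in> V\<close> by (simp add: orthogonal_projection_onto_def)
  finally show ?thesis
    by simp
qed

lemma orthogonal_projection_onto_linear:
  assumes "subspace V" "orthogonal_projection_onto V P"
  shows "linear P"
proof (rule linearI)
  have mem: "P w \<in> V" and orth: "\<forall>y\<in>V. inner (w - P w) y = 0" for w
    using assms(2) by (simp_all add: orthogonal_projection_onto_def)
  show "P (x + y) = P x + P y" for x y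
  proof (rule orthogonal_projection_onto_unique[OF assms])
    show "P x + P y \<in> V"
      using mem assms(1) by (simp add: subspace_add)
    show "\<forall>z\<in>V. inner (x + y - (P x + P y)) z = 0"
    proof
      fix z assume "z \<in> V"
      then have "inner (x - P x) z = 0" "inner (y - P y) z = 0"
        using orth by blast+
      then show "inner (x + y - (P x + P y)) z = 0"
        by (simp add: inner_diff_left inner_add_left)
    qed
  qed
  show "P (c *\<^sub>R x) = c *\<^sub>R P x" for c x
  proof (rule orthogonal_projection_onto_unique[OF assms])
    show "c *\<^sub>R P x \<in> V"
      using mem assms(1) by (simp add: subspace_scale)
    have "c *\<^sub>R x - c *\<^sub>R P x = c *\<^sub>R (x - P x)"
      by (simp add: scaleR_diff_right)
    then show "\<forall>z\<in>V. inner (c *\<^sub>R x - c *\<^sub>R P x) z = 0"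
      using orth by simp
  qed
qed

lemma orthogonal_projection_onto_cross_orthogonal:
  assumes "subspace V" "orthogonal_projection_onto V P" "v \<in> V" "inner v v = 1"
    and "\<forall>y\<in>perp_in V v. inner u y = 0"
  shows "P u = inner u v *\<^sub>R v"
proof (rule orthogonal_projection_onto_unique[OF assms(1,2)])
  show "inner u v *\<^sub>R v \<in> V"
    using assms(1,3) by (rule subspace_scale)
  show "\<forall>y\<in>V. inner (u - inner u v *\<^sub>R v) y = 0"
  proof
    fix y assume "y \<in> V"
    then have "inner u (y - inner y v *\<^sub>R v) = 0"
      using assms(5) diff_proj_in_perp_in[OF assms(1) _ assms(3,4)] by blast
    then show "inner (u - inner u v *\<^sub>R v) y = 0"
      by (simp add: inner_diff_left inner_diff_right inner_commute)
  qed
qed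

lemma largest_angle_pair_projection_eigen:
  assumes "subspace U" "subspace V" "orthogonal_projection_onto U PU" "orthogonal_projection_onto V PV"
    and pair: "largest_angle_pair U V u v"
  shows "PU (PV u) = (inner u v)\<^sup>2 *\<^sub>R u"
proof -
  have "PV u = inner u v *\<^sub>R v" "PU v = inner v u *\<^sub>R u"
    using orthogonal_projection_onto_cross_orthogonal[OF assms(2,4), of v u]
      orthogonal_projection_onto_cross_orthogonal[OF assms(1,3), of u v] pair
    by (simp_all add: largest_angle_pair_def)
  moreover have "PU (inner u v *\<^sub>R v) = inner u v *\<^sub>R PU v"
    using linear_scale[OF orthogonal_projection_onto_linear[OF assms(1,3)]] .
  ultimately show ?thesis
    by (simp add: inner_commute power2_eq_square)
qed

text \<open>A Rayleigh-quotient bound: \<open>\<mu> = \<parallel>PV w\<parallel>\<^sup>2 / \<parallel>w\<parallel>\<^sup>2\<close> for an eigenvector \<open>w \<in> U\<close> of \<open>PU \<circ> PV\<close>.\<close>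
lemma cos_angles_ge_projection_eigenvalue:
  assumes "subspace U" "orthogonal_projection_onto U PU" "orthogonal_projection_onto V PV"
    and cos: "cos_angles_ge U V c" and "c \<ge> 0"
    and "w \<in> U" "w \<noteq> 0" and eig: "PU (PV w) = \<mu> *\<^sub>R w"
  shows "c\<^sup>2 \<le> \<mu>"
proof -
  have "\<mu> * inner w w = inner w (PU (PV w))"
    using eig by simp
  also have "\<dots> = (norm (PV w))\<^sup>2"
    using orthogonal_projection_onto_inner[OF assms(2,6)] orthogonal_projection_onto_inner_self[OF assms(3)]
    by simp
  finally have mu: "\<mu> * inner w w = (norm (PV w))\<^sup>2" .
  obtain v where v: "v \<in> V" "inner v v = 1" "c \<le> \<bar>inner (sgn w) v\<bar>"
    using cos sgn_in_subspace[OF assms(1,6)] unit_sgn[OF assms(7)] unfolding cos_angles_ge_def by blast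
  have "inner (sgn w) v = inner w v / norm w"
    by (simp add: sgn_div_norm divide_inverse)
  then have "c * norm w \<le> \<bar>inner w v\<bar>"
    using v(3) assms(7) by (simp add: pos_le_divide_eq)
  also have "\<dots> = \<bar>inner (PV w) v\<bar>"
    using orthogonal_projection_onto_inner[OF assms(3) v(1)] by (simp add: inner_commute)
  also have "\<dots> \<le> norm (PV w)"
    using Cauchy_Schwarz_ineq2[of "PV w" v] v(2) by (simp add: norm_eq_1[symmetric])
  finally have "c * norm w \<le> norm (PV w)" .
  then have "c\<^sup>2 * inner w w \<le> \<mu> * inner w w"
    using \<open>c \<ge> 0\<close> mu power_mono[of "c * norm w" "norm (PV w)" 2]
    by (simp add: power_mult_distrib power2_norm_eq_inner)
  then show ?thesis
    using assms(7) by simp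
qed

lemma largest_angle_pair_of_projection_nonzero:
  assumes "subspace V" "orthogonal_projection_onto U PU" "orthogonal_projection_onto V PV"
    and "u \<in> U" "inner u u = 1" "PV u \<noteq> 0" and eig: "PU (PV u) = c\<^sup>2 *\<^sub>R u" and "c \<ge> 0"
    and cos: "cos_angles_ge U V c"
  shows "largest_angle_pair U V u (sgn (PV u))"
proof -
  define v where "v = sgn (PV u)"
  have "(norm (PV u))\<^sup>2 = inner u (PU (PV u))"
    using orthogonal_projection_onto_inner[OF assms(2,4)] orthogonal_projection_onto_inner_self[OF assms(3)]
    by simp
  also have "\<dots> = c\<^sup>2"
    using eig assms(5) by simp
  finally have "norm (PV u) = c"
    using \<open>c \<ge> 0\<close> by (simp add: power2_eq_iff_nonneg)
  then have PVu: "PV u = c *\<^sub>R v" and "c > 0"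
    using \<open>PV u \<noteq> 0\<close> by (auto simp: v_def sgn_div_norm)
  have "c * inner u v = c\<^sup>2"
    using orthogonal_projection_onto_inner_self[OF assms(3), of u] \<open>norm (PV u) = c\<close> PVu by simp
  then have "inner u v = c"
    using \<open>c > 0\<close> by (simp add: power2_eq_square)
  moreover have "\<forall>y\<in>perp_in V v. inner u y = 0"
  proof
    fix y assume "y \<in> perp_in V v"
    then have "inner y u = c * inner y v"
      using orthogonal_projection_onto_inner[OF assms(3), of y u] PVu by (simp add: perp_in_def)
    then show "inner u y = 0"
      using \<open>y \<in> perp_in V v\<close> by (simp add: perp_in_def inner_commute)
  qed
  moreover have "\<forall>x\<in>perp_in U u. inner v x = 0"
  proof
    fix x assume "x \<in> perp_in U u"
    then have "c * inner x v = c\<^sup>2 * inner x u"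
      using orthogonal_projection_onto_inner[OF assms(2), of x "PV u"] eig PVu by (simp add: perp_in_def)
    then show "inner v x = 0"
      using \<open>x \<in> perp_in U u\<close> \<open>c > 0\<close> by (simp add: perp_in_def inner_commute)
  qed
  ultimately show ?thesis
    using sgn_in_subspace[OF assms(1) orthogonal_projection_onto_mem[OF assms(3)]] unit_sgn[OF \<open>PV u \<noteq> 0\<close>]
      assms(4,5) cos \<open>c > 0\<close> by (simp add: largest_angle_pair_def v_def)
qed

lemma largest_angle_pair_of_projection_zero:
  fixes U V :: "'a::euclidean_space set"
  assumes "subspace U" "subspace V" "dim U = dim V" "orthogonal_projection_onto V PV"
    and "u \<in> U" "inner u u = 1" "PV u = 0"
  shows "\<exists>v. largest_angle_pair U V u v"
proof -
  have lin: "linear PV"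
    using orthogonal_projection_onto_linear[OF assms(2,4)] .
  define W where "W = PV ` perp_in U u"
  have "subspace W"
    unfolding W_def using linear_subspace_image[OF lin subspace_perp_in[OF assms(1)]] .
  moreover have "W \<subseteq> V"
    using orthogonal_projection_onto_mem[OF assms(4)] by (auto simp: W_def)
  moreover have "dim W < dim V"
  proof -
    have "u \<noteq> 0" "dim U \<noteq> 0"
      using assms(5,6) exists_unit_iff_dim[OF assms(1)] by auto
    then show ?thesis
      using dim_image_le[OF lin, of "perp_in U u"] dim_perp_in[OF assms(1,5)] assms(3)
      unfolding W_def by linarith
  qed
  ultimately have "dim {y\<in>V. \<forall>x\<in>W. orthogonal x y} \<noteq> 0"
    using dim_subspace_orthogonal_to_vectors[of W V] assms(2) by linarith
  then obtain z where z: "z \<in> V" "z \<noteq> 0" "\<forall>x\<in>W. orthogonal x z"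
    by (auto simp: dim_eq_0)
  define v where "v = sgn z"
  have v: "v \<in> V" "inner v v = 1" "\<forall>x\<in>W. inner x v = 0"
    using sgn_in_subspace[OF assms(2) z(1)] unit_sgn[OF z(2)] z(3)
    by (simp_all add: v_def sgn_div_norm orthogonal_def)
  have "inner u v = 0"
    using orthogonal_projection_onto_inner[OF assms(4) v(1), of u] assms(7) by (simp add: inner_commute)
  moreover have "\<forall>y\<in>perp_in V v. inner u y = 0"
    using orthogonal_projection_onto_inner[OF assms(4), of _ u] assms(7)
    by (auto simp: perp_in_def inner_commute)
  moreover have "\<forall>x\<in>perp_in U u. inner v x = 0"
    using v(3) orthogonal_projection_onto_inner[OF assms(4) v(1)] by (auto simp: W_def inner_commute)
  moreover have "cos_angles_ge U V 0"
    using v(1,2) by (auto simp: cos_angles_ge_def)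
  ultimately show ?thesis
    using v(1,2) assms(5,6) unfolding largest_angle_pair_def by auto
qed

lemma largest_angle_pair_of_projection_eigen:
  fixes U V :: "'a::euclidean_space set"
  assumes "subspace U" "subspace V" "dim U = dim V"
    and "orthogonal_projection_onto U PU" "orthogonal_projection_onto V PV"
    and "u \<in> U" "inner u u = 1" "PU (PV u) = c\<^sup>2 *\<^sub>R u" "c \<ge> 0" "cos_angles_ge U V c"
  shows "\<exists>v. largest_angle_pair U V u v"
  using largest_angle_pair_of_projection_nonzero[OF assms(2,4,5,6,7) _ assms(8-10)]
    largest_angle_pair_of_projection_zero[OF assms(1-3,5-7)] by blast

section \<open>The pseudoinverse and the consistency matrix\<close>

lemma full_column_rank_inj: "full_column_rank A \<Longrightarrow> inj ((*v) A)"
  unfolding full_column_rank_def inj_def by (metis eq_iff_diff_eq_0 matrix_vector_mult_diff_distrib)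

lemma inner_matrix_vector_mult: "inner (M *v x) y = inner x (transpose M *v (y::real^'n))"
  by (metis dot_lmul_matrix inner_commute transpose_matrix_vector)

text \<open>For full column rank the pseudoinverse is the left inverse \<open>(A\<^sup>T A)\<^sup>-\<^sup>1 A\<^sup>T\<close>.\<close>
lemma pinv_full_column_rank:
  fixes A :: "real^'m::finite^'n::finite"
  assumes "full_column_rank A"
  shows "A ** pinv A ** A = A" and "transpose (A ** pinv A) = A ** pinv A"
proof -
  define G where "G = transpose A ** A"
  have "G *v x = 0 \<Longrightarrow> x = 0" for x
  proof -
    assume "G *v x = 0"
    then have "inner (A *v x) (A *v x) = 0"
      by (simp add: inner_matrix_vector_mult G_def matrix_vector_mul_assoc)
    then show "x = 0"
      using assms by (simp add: full_column_rank_def)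
  qed
  then obtain K where KG: "K ** G = mat 1"
    using matrix_left_invertible_ker by blast
  then have GK: "G ** K = mat 1"
    using matrix_left_right_inverse by blast
  have "transpose K ** G = mat 1"
    using arg_cong[OF GK, of transpose] by (simp add: G_def matrix_transpose_mul)
  then have Kt: "transpose K = K"
    using GK by (metis matrix_mul_assoc matrix_mul_lid matrix_mul_rid)
  define X where "X = K ** transpose A"
  have XA: "X ** A = mat 1"
    using KG by (simp add: X_def G_def matrix_mul_assoc)
  have penrose: "A ** X ** A = A \<and> X ** A ** X = X \<and> transpose (A ** X) = A ** X \<and>
      transpose (X ** A) = X ** A"
    using XA Kt by (simp add: X_def matrix_transpose_mul matrix_mul_assoc[symmetric])
  have "Y = X" if "A ** Y ** A = A \<and> Y ** A ** Y = Y \<and> transpose (A ** Y) = A ** Y \<and>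
      transpose (Y ** A) = Y ** A" for Y
  proof -
    have "G ** Y = transpose A ** transpose (A ** Y)"
      using that by (simp add: G_def matrix_mul_assoc)
    also have "\<dots> = transpose (A ** Y ** A)"
      by (simp add: matrix_transpose_mul)
    finally have "G ** Y = transpose A"
      using that by simp
    then show ?thesis
      using KG by (metis X_def matrix_mul_assoc matrix_mul_lid)
  qed
  then have "pinv A = X"
    unfolding pinv_def using penrose by blast
  then show "A ** pinv A ** A = A" "transpose (A ** pinv A) = A ** pinv A"
    using penrose by simp_all
qed

lemma orthogonal_projection_onto_range:
  fixes A :: "real^'m::finite^'n::finite"
  assumes "full_column_rank A"
  shows "orthogonal_projection_onto (range ((*v) A)) ((*v) (A ** pinv A))"
  unfolding orthogonal_projection_onto_def
proof (intro allI conjI ballI)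
  fix w
  show "(A ** pinv A) *v w \<in> range ((*v) A)"
    by (metis matrix_vector_mul_assoc rangeI)
  fix y assume "y \<in> range ((*v) A)"
  then obtain c where y: "y = A *v c"
    by blast
  have "inner ((A ** pinv A) *v w) y = inner w ((A ** pinv A ** A) *v c)"
    using pinv_full_column_rank(2)[OF assms]
    by (simp add: inner_matrix_vector_mult y matrix_vector_mul_assoc)
  then show "inner (w - (A ** pinv A) *v w) y = 0"
    using pinv_full_column_rank(1)[OF assms] by (simp add: inner_diff_left y)
qed

lemma dim_range_full_column_rank:
  fixes A :: "real^'m::finite^'n::finite"
  assumes "full_column_rank A"
  shows "dim (range ((*v) A)) = CARD('m)"
proof -
  have "inj_on ((*v) A) (span UNIV)"
    using full_column_rank_inj[OF assms] by (meson inj_on_subset subset_UNIV)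
  then have "dim (range ((*v) A)) = dim (UNIV :: (real^'m) set)"
    by (rule dim_image_eq[OF matrix_vector_mul_linear])
  then show ?thesis
    by simp
qed

lemma consistency_matrix_eigenvector_iff:
  fixes A B :: "real^'m::finite^'n::finite"
  assumes "full_column_rank A"
  shows "real_eigenvector (mat 1 - (pinv A ** B) ** (pinv B ** A)) \<mu> a \<longleftrightarrow>
    a \<noteq> 0 \<and> (A ** pinv A) *v ((B ** pinv B) *v (A *v a)) = (1 - \<mu>) *\<^sub>R (A *v a)"
proof -
  define C where "C = (pinv A ** B) ** (pinv B ** A)"
  have "A *v (C *v a) = (A ** pinv A) *v ((B ** pinv B) *v (A *v a))"
    by (simp add: C_def matrix_vector_mul_assoc matrix_mul_assoc)
  moreover have "A *v (C *v a) = A *v ((1 - \<mu>) *\<^sub>R a) \<longleftrightarrow> C *v a = (1 - \<mu>) *\<^sub>R a"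
    using full_column_rank_inj[OF assms] by (auto dest: injD)
  moreover have "(mat 1 - C) *v a = \<mu> *\<^sub>R a \<longleftrightarrow> C *v a = (1 - \<mu>) *\<^sub>R a"
    by (auto simp: matrix_vector_mult_diff_rdistrib algebra_simps)
  ultimately show ?thesis
    by (simp add: real_eigenvector_def C_def matrix_vector_mult_scaleR)
qed

lemma subspace_range_matrix_vector_mult: "subspace (range ((*v) (M::real^'m::finite^'n::finite)))"
  by (rule linear_subspace_image[OF matrix_vector_mul_linear subspace_UNIV])

context
  fixes A B :: "real^'m::finite^'n::finite"
  assumes rank_A: "full_column_rank A" and rank_B: "full_column_rank B"
begin

lemma dim_range_eq: "dim (range ((*v) A)) = dim (range ((*v) B))"
  using dim_range_full_column_rank[OF rank_A] dim_range_full_column_rank[OF rank_B] by simp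

lemma consistency_largest_eigenvalue:
  assumes eig: "real_eigenvector (mat 1 - (pinv A ** B) ** (pinv B ** A)) lam w"
    and largest: "\<forall>\<mu>. real_eigenvalue (mat 1 - (pinv A ** B) ** (pinv B ** A)) \<mu> \<longrightarrow> \<mu> \<le> lam"
    and complete: "complete_principal_vecs (range ((*v) A)) (range ((*v) B)) ps"
  shows "ps \<noteq> [] \<and> lam = 1 - (inner (fst (last ps)) (snd (last ps)))\<^sup>2"
proof -
  note sub = subspace_range_matrix_vector_mult
  note proj = orthogonal_projection_onto_range[OF rank_A] orthogonal_projection_onto_range[OF rank_B]
  note dims = dim_range_eq
  have "ps \<noteq> []"
    using complete_principal_vecs_length[OF sub sub dims complete] dim_range_full_column_rank[OF rank_A]
    by auto
  define d where "d = inner (fst (last ps)) (snd (last ps))"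
  have pair: "largest_angle_pair (range ((*v) A)) (range ((*v) B)) (fst (last ps)) (snd (last ps))"
    using complete_principal_vecs_last[OF sub sub dims complete \<open>ps \<noteq> []\<close>] .
  then obtain a where a: "fst (last ps) = A *v a"
    by (auto simp: largest_angle_pair_def)
  moreover have "a \<noteq> 0"
    using pair a by (auto simp: largest_angle_pair_def)
  ultimately have "real_eigenvector (mat 1 - (pinv A ** B) ** (pinv B ** A)) (1 - d\<^sup>2) a"
    using largest_angle_pair_projection_eigen[OF sub sub proj pair]
    by (simp add: consistency_matrix_eigenvector_iff[OF rank_A] d_def)
  then have "1 - d\<^sup>2 \<le> lam"
    using largest by (auto simp: real_eigenvalue_def)
  moreover have "d\<^sup>2 \<le> 1 - lam"
  proof -
    have "w \<noteq> 0" "(A ** pinv A) *v ((B ** pinv B) *v (A *v w)) = (1 - lam) *\<^sub>R (A *v w)"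
      using eig by (simp_all add: consistency_matrix_eigenvector_iff[OF rank_A])
    moreover have "A *v w \<noteq> 0"
      using \<open>w \<noteq> 0\<close> rank_A by (auto simp: full_column_rank_def)
    ultimately show ?thesis
      using cos_angles_ge_projection_eigenvalue[OF sub proj, of "\<bar>d\<bar>" "A *v w" "1 - lam"] pair
      by (simp add: largest_angle_pair_def d_def)
  qed
  ultimately show ?thesis
    using \<open>ps \<noteq> []\<close> by (simp add: d_def)
qed

lemma consistency_eigenvector_last_principal:
  assumes eig: "real_eigenvector (mat 1 - (pinv A ** B) ** (pinv B ** A)) lam w"
    and largest: "\<forall>\<mu>. real_eigenvalue (mat 1 - (pinv A ** B) ** (pinv B ** A)) \<mu> \<longrightarrow> \<mu> \<le> lam"
  shows "\<exists>ps. complete_principal_vecs (range ((*v) A)) (range ((*v) B)) ps \<and> ps \<noteq> [] \<and>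
    fst (last ps) = sgn (A *v w)"
proof -
  note sub = subspace_range_matrix_vector_mult
  note proj = orthogonal_projection_onto_range[OF rank_A] orthogonal_projection_onto_range[OF rank_B]
  note dims = dim_range_eq
  obtain ps0 where complete0: "complete_principal_vecs (range ((*v) A)) (range ((*v) B)) ps0"
    using complete_principal_vecs_exists[OF sub sub dims] by blast
  define d where "d = inner (fst (last ps0)) (snd (last ps0))"
  have "ps0 \<noteq> []" and lam: "lam = 1 - d\<^sup>2"
    using consistency_largest_eigenvalue[OF eig largest complete0] by (simp_all add: d_def)
  then have cos: "cos_angles_ge (range ((*v) A)) (range ((*v) B)) \<bar>d\<bar>"
    using complete_principal_vecs_last[OF sub sub dims complete0] by (simp add: largest_angle_pair_def d_def)
  have "w \<noteq> 0" and eig': "(A ** pinv A) *v ((B ** pinv B) *v (A *v w)) = (1 - lam) *\<^sub>R (A *v w)"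
    using eig by (simp_all add: consistency_matrix_eigenvector_iff[OF rank_A])
  then have "A *v w \<noteq> 0"
    using rank_A by (auto simp: full_column_rank_def)
  then have unit: "sgn (A *v w) \<in> range ((*v) A)" "inner (sgn (A *v w)) (sgn (A *v w)) = 1"
    using sgn_in_subspace[OF sub rangeI, of A w] unit_sgn[of "A *v w"] by simp_all
  have "(A ** pinv A) *v ((B ** pinv B) *v sgn (A *v w)) = \<bar>d\<bar>\<^sup>2 *\<^sub>R sgn (A *v w)"
    using eig' lam by (simp add: sgn_div_norm matrix_vector_mult_scaleR)
  then obtain v where "largest_angle_pair (range ((*v) A)) (range ((*v) B)) (sgn (A *v w)) v"
    using largest_angle_pair_of_projection_eigen[OF sub sub dims proj unit _ abs_ge_zero cos] by blast
  then obtain ps where "complete_principal_vecs (range ((*v) A)) (range ((*v) B)) ps" "ps \<noteq> []"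
      "last ps = (sgn (A *v w), v)"
    using complete_principal_vecs_ending_in[OF sub sub dims] by blast
  then show ?thesis
    by auto
qed

end

section \<open>Observables sampled at the data points\<close>

definition pullback_inner :: "('b \<Rightarrow> 'a::real_inner) \<Rightarrow> 'b \<Rightarrow> 'b \<Rightarrow> real" where
  "pullback_inner ev f g = inner (ev f) (ev g)"

lemma admissible_pair_pullback_inner:
  assumes "u \<in> S" "v \<in> K"
  shows "admissible_pair (pullback_inner ev) S K prev u v \<longleftrightarrow>
    admissible_vecs (ev ` S) (ev ` K) (map (map_prod ev ev) prev) (ev u) (ev v)"
  using assms by (auto simp: admissible_pair_def admissible_vecs_def pullback_inner_def)

lemma admissible_pair_pullback_inner_bound:
  "(\<forall>u v. admissible_pair (pullback_inner ev) S K prev u v \<longrightarrow> \<bar>pullback_inner ev u v\<bar> \<le> r) \<longleftrightarrow>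
   (\<forall>u v. admissible_vecs (ev ` S) (ev ` K) (map (map_prod ev ev) prev) u v \<longrightarrow> \<bar>inner u v\<bar> \<le> r)"
proof
  assume bound: "\<forall>u v. admissible_pair (pullback_inner ev) S K prev u v \<longrightarrow> \<bar>pullback_inner ev u v\<bar> \<le> r"
  show "\<forall>u v. admissible_vecs (ev ` S) (ev ` K) (map (map_prod ev ev) prev) u v \<longrightarrow> \<bar>inner u v\<bar> \<le> r"
  proof (intro allI impI)
    fix y z assume adm: "admissible_vecs (ev ` S) (ev ` K) (map (map_prod ev ev) prev) y z"
    then obtain u v where "u \<in> S" "v \<in> K" "y = ev u" "z = ev v"
      by (auto simp: admissible_vecs_def)
    then show "\<bar>inner y z\<bar> \<le> r"
      using bound adm admissible_pair_pullback_inner by (metis pullback_inner_def)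
  qed
next
  assume bound: "\<forall>u v. admissible_vecs (ev ` S) (ev ` K) (map (map_prod ev ev) prev) u v \<longrightarrow> \<bar>inner u v\<bar> \<le> r"
  show "\<forall>u v. admissible_pair (pullback_inner ev) S K prev u v \<longrightarrow> \<bar>pullback_inner ev u v\<bar> \<le> r"
  proof (intro allI impI)
    fix u v assume adm: "admissible_pair (pullback_inner ev) S K prev u v"
    then have "u \<in> S" "v \<in> K"
      by (auto simp: admissible_pair_def)
    then show "\<bar>pullback_inner ev u v\<bar> \<le> r"
      using bound adm admissible_pair_pullback_inner by (metis pullback_inner_def)
  qed
qed

lemma principal_seq_pullback_inner_iff:
  assumes "\<forall>p\<in>set ps. fst p \<in> S \<and> snd p \<in> K"
  shows "principal_seq (pullback_inner ev) S K ps \<longleftrightarrow>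
    principal_vecs (ev ` S) (ev ` K) (map (map_prod ev ev) ps)"
proof -
  have "fst (ps ! j) \<in> S" "snd (ps ! j) \<in> K" if "j < length ps" for j
    using assms that by auto
  then show ?thesis
    unfolding principal_seq_def principal_vecs_def
    by (simp add: take_map admissible_pair_pullback_inner admissible_pair_pullback_inner_bound)
       (simp add: pullback_inner_def)
qed

lemma principal_seq_mem:
  "principal_seq ip S K ps \<Longrightarrow> p \<in> set ps \<Longrightarrow> fst p \<in> S \<and> snd p \<in> K"
  by (auto simp: principal_seq_def admissible_pair_def in_set_conv_nth)

lemma complete_principal_seq_pullback_inner_iff:
  assumes "\<forall>p\<in>set ps. fst p \<in> S \<and> snd p \<in> K"
  shows "complete_principal_seq (pullback_inner ev) S K ps \<longleftrightarrow>
    complete_principal_vecs (ev ` S) (ev ` K) (map (map_prod ev ev) ps)"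
  unfolding complete_principal_seq_def complete_principal_vecs_def
    principal_seq_pullback_inner_iff[OF assms]
  by (auto simp: pullback_inner_def)

lemma complete_principal_seq_image:
  "complete_principal_seq (pullback_inner ev) S K ps \<Longrightarrow>
    complete_principal_vecs (ev ` S) (ev ` K) (map (map_prod ev ev) ps)"
  using complete_principal_seq_pullback_inner_iff principal_seq_mem
  by (metis complete_principal_seq_def)

lemma complete_principal_vecs_lift:
  assumes "complete_principal_vecs (ev ` S) (ev ` K) qs"
  shows "\<exists>ps. complete_principal_seq (pullback_inner ev) S K ps \<and> map (map_prod ev ev) ps = qs"
proof -
  define ps where "ps = map (map_prod (inv_into S ev) (inv_into K ev)) qs"
  have qs: "\<forall>q\<in>set qs. fst q \<in> ev ` S \<and> snd q \<in> ev ` K"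
    using assms principal_vecs_mem by (fastforce simp: complete_principal_vecs_def)
  then have "\<forall>p\<in>set ps. fst p \<in> S \<and> snd p \<in> K"
    by (auto simp: ps_def inv_into_into)
  moreover have "map (map_prod ev ev) ps = qs"
    using qs by (auto simp: ps_def f_inv_into_f intro!: map_idI)
  ultimately show ?thesis
    using complete_principal_seq_pullback_inner_iff assms by metis
qed

lemma sin_arccos_abs_squared: "\<bar>x\<bar> \<le> 1 \<Longrightarrow> (sin (arccos \<bar>x\<bar>))\<^sup>2 = 1 - x\<^sup>2"
  by (simp add: sin_arccos abs_square_le_1)

definition sample_vec :: "('n::finite \<Rightarrow> 'x) \<Rightarrow> ('x \<Rightarrow> real) \<Rightarrow> real^'n" where
  "sample_vec xs f = (\<chi> i. f (xs i) / sqrt (real CARD('n)))"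

lemma emp_ip_eq_pullback_inner:
  fixes xs :: "'n::finite \<Rightarrow> 'x"
  shows "emp_ip xs = pullback_inner (sample_vec xs)"
proof (intro ext)
  fix f g :: "'x \<Rightarrow> real"
  have "sqrt (real CARD('n)) * sqrt (real CARD('n)) = real CARD('n)"
    by simp
  then show "emp_ip xs f g = pullback_inner (sample_vec xs) f g"
    by (simp add: emp_ip_def pullback_inner_def sample_vec_def inner_vec_def sum_divide_distrib)
qed

lemma sample_vec_koopman: "sample_vec xs (koopman T f) = sample_vec (\<lambda>i. T (xs i)) f"
  by (simp add: sample_vec_def koopman_def)

lemma sample_vec_dict_comb:
  fixes xs :: "'n::finite \<Rightarrow> 'x"
  shows "sample_vec xs (dict_comb \<psi> c) = data_matrix \<psi> xs *v ((1 / sqrt (real CARD('n))) *\<^sub>R c)"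
  by (simp add: sample_vec_def dict_comb_def data_matrix_def matrix_vector_mult_def vec_eq_iff
      sum_divide_distrib mult.commute)

lemma sample_vec_dict_span:
  fixes xs :: "'n::finite \<Rightarrow> 'x"
  shows "sample_vec xs ` dict_span \<psi> = range ((*v) (data_matrix \<psi> xs))"
proof
  show "sample_vec xs ` dict_span \<psi> \<subseteq> range ((*v) (data_matrix \<psi> xs))"
    by (auto simp: dict_span_def sample_vec_dict_comb)
  show "range ((*v) (data_matrix \<psi> xs)) \<subseteq> sample_vec xs ` dict_span \<psi>"
  proof
    fix y assume "y \<in> range ((*v) (data_matrix \<psi> xs))"
    then obtain c where "y = data_matrix \<psi> xs *v c"
      by blast
    then have "y = sample_vec xs (dict_comb \<psi> (sqrt (real CARD('n)) *\<^sub>R c))"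
      by (simp add: sample_vec_dict_comb)
    then show "y \<in> sample_vec xs ` dict_span \<psi>"
      by (simp add: dict_span_def)
  qed
qed

lemma inj_on_sample_vec_dict_span:
  fixes xs :: "'n::finite \<Rightarrow> 'x"
  assumes "full_column_rank (data_matrix \<psi> xs)"
  shows "inj_on (sample_vec xs) (dict_span \<psi>)"
proof (rule inj_onI)
  fix f g assume "f \<in> dict_span \<psi>" "g \<in> dict_span \<psi>" "sample_vec xs f = sample_vec xs g"
  then obtain a b where ab: "f = dict_comb \<psi> a" "g = dict_comb \<psi> b"
    and "data_matrix \<psi> xs *v ((1 / sqrt (real CARD('n))) *\<^sub>R a) =
      data_matrix \<psi> xs *v ((1 / sqrt (real CARD('n))) *\<^sub>R b)"
    by (auto simp: dict_span_def sample_vec_dict_comb)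
  then have "(1 / sqrt (real CARD('n))) *\<^sub>R a = (1 / sqrt (real CARD('n))) *\<^sub>R b"
    using injD[OF full_column_rank_inj[OF assms]] by blast
  then show "f = g"
    using ab by simp
qed

lemma sample_vec_divide: "sample_vec xs (\<lambda>y. f y / c) = (1 / c) *\<^sub>R sample_vec xs f"
  by (simp add: sample_vec_def vec_eq_iff)

lemma dict_comb_divide: "(\<lambda>y. dict_comb \<psi> v y / c) = dict_comb \<psi> ((1 / c) *\<^sub>R v)"
  by (simp add: dict_comb_def fun_eq_iff sum_divide_distrib)

lemma sample_vec_normalize:
  "sample_vec xs (\<lambda>y. f y / sqrt (emp_ip xs f f)) = sgn (sample_vec xs f)"
  unfolding sample_vec_divide
  by (simp add: emp_ip_eq_pullback_inner pullback_inner_def norm_eq_sqrt_inner sgn_div_norm divide_inverse)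

lemma sgn_sample_vec_dict_comb:
  "sgn (sample_vec xs (dict_comb \<psi> v)) = sgn (data_matrix \<psi> xs *v v)"
  by (simp add: sample_vec_dict_comb matrix_vector_mult_scaleR sgn_scaleR)

lemma remove_dir_emp_ip_divide:
  "c \<noteq> 0 \<Longrightarrow> remove_dir (emp_ip xs) S (\<lambda>y. f y / c) = remove_dir (emp_ip xs) S f"
  by (simp add: remove_dir_def emp_ip_def flip: sum_divide_distrib)

lemma sample_vec_koopman_dict_span:
  "sample_vec xs ` koopman T ` dict_span \<psi> = range ((*v) (data_matrix \<psi> (\<lambda>i. T (xs i))))"
  by (simp add: image_image sample_vec_koopman sample_vec_dict_span)

lemma emp_ip_dict_comb_nonzero:
  assumes "full_column_rank (data_matrix \<psi> xs)" "v \<noteq> 0"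
  shows "emp_ip xs (dict_comb \<psi> v) (dict_comb \<psi> v) \<noteq> 0"
proof -
  have "data_matrix \<psi> xs *v v \<noteq> 0"
    using assms by (auto simp: full_column_rank_def)
  then have "sample_vec xs (dict_comb \<psi> v) \<noteq> 0"
    using sgn_sample_vec_dict_comb[of xs \<psi> v] by (auto simp: sgn_zero_iff)
  then show ?thesis
    by (simp add: emp_ip_eq_pullback_inner pullback_inner_def)
qed

context
  fixes T :: "'x \<Rightarrow> 'x" and xs :: "'n::finite \<Rightarrow> 'x" and \<psi> :: "'m::finite \<Rightarrow> 'x \<Rightarrow> real"
  assumes rank_X: "full_column_rank (data_matrix \<psi> xs)"
    and rank_Y: "full_column_rank (data_matrix \<psi> (\<lambda>i. T (xs i)))"
begin

lemma largest_principal_angle_consistency_eigenvalue: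
  defines "M \<equiv> mat 1 - (pinv (data_matrix \<psi> xs) ** data_matrix \<psi> (\<lambda>i. T (xs i))) **
    (pinv (data_matrix \<psi> (\<lambda>i. T (xs i))) ** data_matrix \<psi> xs)"
  assumes eig: "real_eigenvector M lam v" and largest: "\<forall>\<mu>. real_eigenvalue M \<mu> \<longrightarrow> \<mu> \<le> lam"
    and complete: "complete_principal_seq (emp_ip xs) (dict_span \<psi>) (koopman T ` dict_span \<psi>) ps"
  shows "ps \<noteq> [] \<and> (\<forall>p\<in>set ps. pangle (emp_ip xs) p \<le> pangle (emp_ip xs) (last ps)) \<and>
    lam = (sin (pangle (emp_ip xs) (last ps)))\<^sup>2"
proof -
  let ?qs = "map (map_prod (sample_vec xs) (sample_vec xs)) ps"
  have pangle: "pangle (emp_ip xs) p = arccos \<bar>inner (sample_vec xs (fst p)) (sample_vec xs (snd p))\<bar>" for p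
    by (simp add: pangle_def emp_ip_eq_pullback_inner pullback_inner_def)
  have qs: "complete_principal_vecs (range ((*v) (data_matrix \<psi> xs)))
      (range ((*v) (data_matrix \<psi> (\<lambda>i. T (xs i))))) ?qs"
    using complete_principal_seq_image[of "sample_vec xs" "dict_span \<psi>" "koopman T ` dict_span \<psi>" ps] complete
    by (simp add: emp_ip_eq_pullback_inner sample_vec_dict_span sample_vec_koopman_dict_span)
  then have "ps \<noteq> []" and lam: "lam = 1 - (inner (fst (last ?qs)) (snd (last ?qs)))\<^sup>2"
    using consistency_largest_eigenvalue[OF rank_X rank_Y eig[unfolded M_def] largest[unfolded M_def]]
    by auto
  have principal: "principal_vecs (range ((*v) (data_matrix \<psi> xs)))
      (range ((*v) (data_matrix \<psi> (\<lambda>i. T (xs i))))) ?qs"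
    using qs by (simp add: complete_principal_vecs_def)
  have "\<bar>inner (fst (last ?qs)) (snd (last ?qs))\<bar> \<le> 1"
    using principal_vecs_abs_inner_le_1[OF principal last_in_set[of ?qs]] \<open>ps \<noteq> []\<close> by simp
  moreover have "pangle (emp_ip xs) p \<le> pangle (emp_ip xs) (last ps)" if "p \<in> set ps" for p
    using principal_vecs_arccos_le_last[OF principal, of "map_prod (sample_vec xs) (sample_vec xs) p"]
      that \<open>ps \<noteq> []\<close> by (simp add: pangle last_map)
  ultimately show ?thesis
    using \<open>ps \<noteq> []\<close> lam sin_arccos_abs_squared by (simp add: pangle last_map)
qed

lemma consistency_eigenvector_principal_vector:
  defines "M \<equiv> mat 1 - (pinv (data_matrix \<psi> xs) ** data_matrix \<psi> (\<lambda>i. T (xs i))) **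
    (pinv (data_matrix \<psi> (\<lambda>i. T (xs i))) ** data_matrix \<psi> xs)"
  assumes eig: "real_eigenvector M lam v" and largest: "\<forall>\<mu>. real_eigenvalue M \<mu> \<longrightarrow> \<mu> \<le> lam"
  shows "\<exists>ps. complete_principal_seq (emp_ip xs) (dict_span \<psi>) (koopman T ` dict_span \<psi>) ps \<and>
    ps \<noteq> [] \<and> fst (last ps) = (\<lambda>y. dict_comb \<psi> v y / sqrt (emp_ip xs (dict_comb \<psi> v) (dict_comb \<psi> v)))"
proof -
  define F where "F = (\<lambda>y. dict_comb \<psi> v y / sqrt (emp_ip xs (dict_comb \<psi> v) (dict_comb \<psi> v)))"
  obtain qs where qs: "complete_principal_vecs (sample_vec xs ` dict_span \<psi>)
      (sample_vec xs ` koopman T ` dict_span \<psi>) qs" "qs \<noteq> []"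
      "fst (last qs) = sgn (data_matrix \<psi> xs *v v)"
    using consistency_eigenvector_last_principal[OF rank_X rank_Y eig[unfolded M_def] largest[unfolded M_def]]
    by (auto simp: sample_vec_dict_span sample_vec_koopman_dict_span)
  then obtain ps where ps: "complete_principal_seq (emp_ip xs) (dict_span \<psi>) (koopman T ` dict_span \<psi>) ps"
      "map (map_prod (sample_vec xs) (sample_vec xs)) ps = qs"
    using complete_principal_vecs_lift by (metis emp_ip_eq_pullback_inner)
  then have "ps \<noteq> []"
    using qs(2) by auto
  then have "sample_vec xs (fst (last ps)) = sample_vec xs F" "fst (last ps) \<in> dict_span \<psi>"
    using ps qs(3) principal_seq_mem[of _ "dict_span \<psi>" _ ps "last ps"]
    by (auto simp: last_map complete_principal_seq_def F_def sample_vec_normalize sgn_sample_vec_dict_comb)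
  moreover have "F \<in> dict_span \<psi>"
    by (simp add: F_def dict_comb_divide dict_span_def)
  ultimately have "fst (last ps) = F"
    using inj_on_sample_vec_dict_span[OF rank_X] by (metis inj_onD)
  then show ?thesis
    using ps(1) \<open>ps \<noteq> []\<close> by (auto simp: F_def)
qed

end

theorem theorem3:
  fixes T :: "'x \<Rightarrow> 'x"
    and xs :: "'n::finite \<Rightarrow> 'x"
    and \<psi> :: "'m::finite \<Rightarrow> 'x \<Rightarrow> real"
    and lam_max :: real and vmax :: "real^'m"
  defines "A \<equiv> data_matrix \<psi> xs"
    and "B \<equiv> data_matrix \<psi> (\<lambda>i. T (xs i))"
    and "ip \<equiv> emp_ip xs"
    and "S \<equiv> dict_span \<psi>"
  assumes rkA: "full_column_rank A"
    and rkB: "full_column_rank B"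
    and eig: "real_eigenvector (mat 1 - (pinv A ** B) ** (pinv B ** A)) lam_max vmax"
    and largest: "\<forall>\<mu>. real_eigenvalue (mat 1 - (pinv A ** B) ** (pinv B ** A)) \<mu> \<longrightarrow> \<mu> \<le> lam_max"
  shows "(\<forall>ps. complete_principal_seq ip S (koopman T ` S) ps \<longrightarrow>
             ps \<noteq> [] \<and>
             (\<forall>p\<in>set ps. pangle ip p \<le> pangle ip (last ps)) \<and>
             lam_max = (sin (pangle ip (last ps)))\<^sup>2)
      \<and> (\<exists>ps. complete_principal_seq ip S (koopman T ` S) ps \<and> ps \<noteq> [] \<and>
             fst (last ps) = (\<lambda>y. dict_comb \<psi> vmax y / sqrt (ip (dict_comb \<psi> vmax) (dict_comb \<psi> vmax))) \<and>
             remove_dir ip S (fst (last ps)) = remove_dir ip S (dict_comb \<psi> vmax))"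
proof -
  note rank = rkA[unfolded A_def] rkB[unfolded B_def]
  note eigen = eig[unfolded A_def B_def] largest[unfolded A_def B_def]
  have "sqrt (ip (dict_comb \<psi> vmax) (dict_comb \<psi> vmax)) \<noteq> 0"
    using emp_ip_dict_comb_nonzero[OF rank(1)] eig by (simp add: ip_def real_eigenvector_def)
  then show ?thesis
    using largest_principal_angle_consistency_eigenvalue[OF rank eigen]
      consistency_eigenvector_principal_vector[OF rank eigen]
    by (auto simp: ip_def S_def remove_dir_emp_ip_divide)
qed

end
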